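(* Let $\mu=\mu_{a,t}^p$ be a homogeneous self-similar measure on $\mathbb{R}$ which is not a single atom. There exists $\sigma=\sigma(\mu)>0$ such that for every $F\in C^2(\mathbb{R})$ (real-valued) with $F''>0$ there is a constant $C=C(F,\mu)>0$ such that \[ |\widehat{F\mu}(u)|\le C|u|^{-\sigma}\qquad\text{for all } u\in\mathbb{R}\setminus\{0\}. \]
   Context: For $a\in(0,1)$, $t=(t_1,\ldots,t_m)\in\mathbb{R}^m$ and a probability vector $p=(p_1,\ldots,p_m)$, the homogeneous self-similar measure $\mu_{a,t}^p$ (for the iterated function system $\{ax+t_i\}_{i=1}^m$ with weights $p$) is the distribution of the random sum $\sum_{n=1}^\infty X_na^n$, where the $X_n$ are independent and identically distributed with $\mathbb{P}(X_n=t_i)=p_i$. No separation condition is assumed. $F\mu$ denotes the push-forward measure $F\mu(A)=\mu(F^{-1}A)$ for Borel sets $A\subset\mathbb{R}$, and the Fourier transform of a finite Borel measure $\mu$ on $\mathbb{R}$ is $\widehat{\mu}(\xi)=\int e^{2\pi i\xi x}\,d\mu(x)$. *)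

theory Defs
  imports "HOL-Probability.Probability"
begin

definition probability_vector :: "real ^ 'm \<Rightarrow> bool" where
  "probability_vector p \<longleftrightarrow> (\<forall>i. 0 \<le> p $ i) \<and> (\<Sum>i\<in>UNIV. p $ i) = 1"

(* The underlying probability space consists of the index sequences (w 0, w 1, ...), chosen
   independently with P(w n = i) = p $ i.  On it, X_(n+1) = t $ (w n) is the i.i.d. sequence with
   values in {t $ i} and weights p (coinciding t $ i add up their weights), and the measure is the
   distribution of the sum of X_n * a ^ n over n >= 1. *)
definition self_similar_measure :: "real \<Rightarrow> real ^ 'm \<Rightarrow> real ^ 'm \<Rightarrow> real measure" where
  "self_similar_measure a t p =
     distr (\<Pi>\<^sub>M n\<in>(UNIV :: nat set). point_measure UNIV (\<lambda>i. ennreal (p $ i))) borel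
       (\<lambda>w. \<Sum>n. t $ (w n) * a ^ Suc n)"

(* Positive sign and 2 pi in the exponent, unlike the library's char. *)
definition fourier_transform :: "real measure \<Rightarrow> real \<Rightarrow> complex" where
  "fourier_transform M \<xi> = (LINT x|M. exp (2 * of_real pi * \<i> * of_real \<xi> * of_real x))"

definition C2 :: "(real \<Rightarrow> real) \<Rightarrow> bool" where
  "C2 F \<longleftrightarrow> F differentiable_on UNIV \<and> deriv F differentiable_on UNIV \<and>
     continuous_on UNIV (deriv (deriv F))"

end

theory Submission
  imports Defs
begin

text \<open>
The Fourier transform of \<open>\<mu>\<close> need not decay, but it is small except on a very sparse set of
frequencies, and a strictly convex map does not let the measure concentrate on such a set.

Write the random series as its partial sum \<open>y\<close> of \<open>n\<close> terms plus an independent copy of itself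
scaled by \<open>a ^ n\<close> (\<open>integral_words\<close>). On each scaled copy, \<open>F\<close> is linear up to an error of order
\<open>(a ^ n)\<^sup>2\<close>, so the transform of the image at \<open>u\<close> is bounded by the mean over \<open>y\<close> of the modulus
of the transform of \<open>\<mu>\<close> at \<open>u * a ^ n * F' y\<close>, plus a constant times \<open>\<bar>u\<bar> * (a ^ n)\<^sup>2\<close>
(\<open>fourier_image_linearised\<close>). With \<open>\<bar>u\<bar>\<close> of order \<open>a powr (- 3 * n / 2)\<close> this error is of
order \<open>a powr (n / 2)\<close>.

The mean is controlled by two facts about \<open>\<mu>\<close>. First, \<open>\<mu>\<close> satisfies a Frostman condition
\<open>measure \<mu> (cball x r) \<le> C * r powr s\<close> (\<open>measure_cball_le_powr\<close>), because two distinct translations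
produce well separated copies of \<open>\<mu>\<close> in itself at every scale. As \<open>F'\<close> expands distances, the
slopes \<open>F' y\<close> inherit this condition (\<open>sum_weight_same_round_le\<close>).

Second, for a large exponent \<open>Q\<close> the \<open>Q\<close>-th moment of the transform of \<open>\<mu>\<close> over separated
frequencies in a range of length \<open>a\<close> to the power \<open>-N\<close> is at most \<open>(1 + \<delta>) ^ N\<close> up to a
constant, with \<open>\<delta>\<close> arbitrarily small (\<open>fourier_moment_bound\<close>). This is the Erdos--Kahane
argument: the transform is an infinite product over scales, a factor is bounded away from 1
unless the rescaled frequency is near an integer, and when this happens at two consecutive
scales, the integer at the finer one is determined by the integer at the coarser one
(\<open>sum_lacunary_products_le\<close>).

Choosing \<open>\<delta>\<close> small in terms of \<open>s\<close>, the Frostman gain beats the growth of the moment, so the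
\<open>Q\<close>-th moment over \<open>y\<close>, and with it the mean, decays exponentially in \<open>n\<close>, that is, like a
power of \<open>\<bar>u\<bar>\<close>.\<close>

section \<open>An Erdos--Kahane argument in moment form\<close>

lemma card_round_injective_le:
  fixes E :: "real set"
  assumes "finite E" and "inj_on round E" and "\<And>b. b \<in> E \<Longrightarrow> \<bar>b - c\<bar> \<le> r" and "0 \<le> r"
  shows "real (card E) \<le> 2 * r + 2"
proof -
  have "card E = card (round ` E)"
    using assms(2) by (simp add: card_image)
  also have "\<dots> \<le> card {\<lceil>c - r - 1/2\<rceil>..\<lfloor>c + r + 1/2\<rfloor>}"
  proof (rule card_mono)
    show "round ` E \<subseteq> {\<lceil>c - r - 1/2\<rceil>..\<lfloor>c + r + 1/2\<rfloor>}"
    proof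
      fix k :: int assume "k \<in> round ` E"
      then obtain b where b: "b \<in> E" "k = round b" by auto
      have "\<bar>b - c\<bar> \<le> r" using assms(3) b(1) .
      moreover have "\<bar>of_int k - b\<bar> \<le> 1/2" unfolding b(2) by (rule of_int_round_abs_le)
      ultimately have "c - r - 1/2 \<le> of_int k" "of_int k \<le> c + r + 1/2" by linarith+
      then show "k \<in> {\<lceil>c - r - 1/2\<rceil>..\<lfloor>c + r + 1/2\<rfloor>}"
        by (auto simp: ceiling_le_iff le_floor_iff)
    qed
  qed simp
  also have "real \<dots> \<le> 2 * r + 2"
    using assms(4) by simp linarith
  finally show ?thesis by simp
qed

text \<open>Within each class of points whose images round to the same integer, move all the mass to the
member where \<open>h\<close> is largest. The selected values form a set on which rounding is injective;
sums of \<open>h\<close> over such sets are what the recursion in \<open>sum_lacunary_products_le\<close> controls.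
This replaces suprema of \<open>h\<close> over unit intervals by values at actual points.\<close>

lemma weighted_sum_le_separated_sum:
  fixes q \<beta> :: "'a \<Rightarrow> real" and h :: "real \<Rightarrow> real"
  assumes "finite X" and "\<And>x. x \<in> X \<Longrightarrow> 0 \<le> q x" and "\<And>b. 0 \<le> h b"
    and mass: "\<And>k. (\<Sum>x | x \<in> X \<and> round (\<beta> x) = k. q x) \<le> m"
  shows "\<exists>E. E \<subseteq> \<beta> ` X \<and> inj_on round E \<and> (\<Sum>x\<in>X. q x * h (\<beta> x)) \<le> m * (\<Sum>b\<in>E. h b)"
proof -
  define K where "K = (\<lambda>x. round (\<beta> x)) ` X"
  define G where "G k = {x \<in> X. round (\<beta> x) = k}" for k
  have "\<exists>x\<in>G k. \<forall>y\<in>G k. h (\<beta> y) \<le> h (\<beta> x)" if "k \<in> K" for k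
  proof -
    have fin: "finite (G k)" and ne: "G k \<noteq> {}" using assms(1) that by (auto simp: G_def K_def)
    have "Max ((\<lambda>x. h (\<beta> x)) ` G k) \<in> (\<lambda>x. h (\<beta> x)) ` G k"
      using fin ne by (intro Max_in) auto
    then obtain x where "x \<in> G k" "h (\<beta> x) = Max ((\<lambda>x. h (\<beta> x)) ` G k)" by auto
    then show ?thesis using fin by (intro bexI[of _ x]) auto
  qed
  then obtain e where e: "\<And>k. k \<in> K \<Longrightarrow> e k \<in> G k"
    and emax: "\<And>k y. k \<in> K \<Longrightarrow> y \<in> G k \<Longrightarrow> h (\<beta> y) \<le> h (\<beta> (e k))"
    by metis
  have re: "round (\<beta> (e k)) = k" "e k \<in> X" if "k \<in> K" for k using e[OF that] by (auto simp: G_def)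
  let ?E = "(\<lambda>k. \<beta> (e k)) ` K"
  have inj: "inj_on (\<lambda>k. \<beta> (e k)) K" by (rule inj_on_inverseI[of _ round]) (simp add: re)
  have "(\<Sum>x\<in>X. q x * h (\<beta> x)) = (\<Sum>k\<in>K. \<Sum>x\<in>G k. q x * h (\<beta> x))"
    unfolding K_def G_def using assms(1) by (rule sum.image_gen)
  also have "\<dots> \<le> (\<Sum>k\<in>K. m * h (\<beta> (e k)))"
  proof (rule sum_mono)
    fix k assume k: "k \<in> K"
    have "(\<Sum>x\<in>G k. q x * h (\<beta> x)) \<le> (\<Sum>x\<in>G k. q x * h (\<beta> (e k)))"
      using assms(2) emax[OF k] by (intro sum_mono mult_left_mono) (auto simp: G_def)
    also have "\<dots> = (\<Sum>x\<in>G k. q x) * h (\<beta> (e k))" by (simp add: sum_distrib_right)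
    also have "\<dots> \<le> m * h (\<beta> (e k))"
      using mass[of k] assms(3) by (intro mult_right_mono) (auto simp: G_def)
    finally show "(\<Sum>x\<in>G k. q x * h (\<beta> x)) \<le> m * h (\<beta> (e k))" .
  qed
  also have "\<dots> = m * (\<Sum>b\<in>?E. h b)"
    by (simp add: sum.reindex[OF inj] sum_distrib_left)
  finally have "(\<Sum>x\<in>X. q x * h (\<beta> x)) \<le> m * (\<Sum>b\<in>?E. h b)" .
  moreover have "?E \<subseteq> \<beta> ` X" using re by auto
  moreover have "inj_on round ?E" by (rule inj_on_inverseI[of _ "\<lambda>k. \<beta> (e k)"]) (auto simp: re)
  ultimately show ?thesis by blast
qed

definition near_int :: "real \<Rightarrow> real \<Rightarrow> bool" where
  "near_int \<rho> b \<longleftrightarrow> \<bar>b - of_int (round b)\<bar> < \<rho>"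

text \<open>Up to an error below \<open>1/2\<close>, the integer next to \<open>b\<close> is the integer next to \<open>a * b\<close> divided
by \<open>a\<close>. Going from coarse to fine scales, the nearest integer is therefore forced at every
step where both numbers are close to integers. This is the deterministic core of the
Erdos--Kahane argument.\<close>

lemma near_int_predecessor_unique:
  assumes "0 < a" and "\<rho> * (1 + a) \<le> a / 2"
    and "near_int \<rho> b" "near_int \<rho> (a * b)" "near_int \<rho> b'" "near_int \<rho> (a * b')"
    and "round (a * b) = round (a * b')"
  shows "round b = round b'"
proof -
  let ?k = "of_int (round b) :: real" and ?k' = "of_int (round b') :: real"
  let ?l = "of_int (round (a * b)) :: real"
  have step: "\<bar>a * of_int (round x) - ?l\<bar> < a / 2"
    if "near_int \<rho> x" "near_int \<rho> (a * x)" "round (a * x) = round (a * b)" for x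
  proof -
    have "\<bar>a * of_int (round x) - a * x\<bar> < a * \<rho>"
      using that(1) assms(1) by (simp add: near_int_def abs_mult abs_minus_commute flip: right_diff_distrib)
    moreover have "\<bar>a * x - ?l\<bar> < \<rho>" using that(2,3) by (simp add: near_int_def)
    moreover have "a * \<rho> + \<rho> \<le> a / 2" using assms(2) by (simp add: algebra_simps)
    ultimately show ?thesis by linarith
  qed
  have "\<bar>a * ?k - a * ?k'\<bar> < a"
    using step[of b] step[of b'] assms by linarith
  then have "\<bar>?k - ?k'\<bar> < 1"
    using assms(1) by (simp add: abs_mult flip: right_diff_distrib)
  then show ?thesis by linarith
qed

text \<open>A point \<open>b\<close> whose product is not tiny must have \<open>b\<close>, \<open>a * b\<close>, \<open>a\<^sup>2 * b\<close>, ... close to integers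
most of the time, and then its nearest integer is almost determined by the scale
\<open>a ^ N\<close>. Induct on the number of scales and group the points by the integer nearest to
\<open>a * b\<close>. A group has at most one point of the close type, by \<open>near_int_predecessor_unique\<close>,
which costs a factor 1; it has at most \<open>3 / a\<close> points altogether, and each of the others costs
\<open>\<theta>\<close>. So one scale costs \<open>1 + 3 * \<theta> / a\<close>, which is as near to 1 as desired when \<open>\<theta>\<close> is small,
although the points spread over a range of length about \<open>a\<close> to the power \<open>-N\<close>. No count of
patterns of good and bad scales is needed.\<close>

lemma sum_lacunary_products_le:
  fixes g :: "real \<Rightarrow> real"
  assumes a: "0 < a" "a < 1" and \<rho>: "\<rho> * (1 + a) \<le> a / 2" and "0 \<le> \<theta>"
    and g: "\<And>b. 0 \<le> g b" "\<And>b. g b \<le> 1"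
    and small: "\<And>b. \<not> (near_int \<rho> b \<and> near_int \<rho> (a * b)) \<Longrightarrow> g b \<le> \<theta>"
    and "0 \<le> A"
  shows "\<lbrakk>finite E; inj_on round E; \<And>b. b \<in> E \<Longrightarrow> \<bar>b\<bar> * a ^ N \<le> A\<rbrakk> \<Longrightarrow>
    (\<Sum>b\<in>E. \<Prod>n<N. g (a ^ n * b)) \<le> (2 * A + 2) * (1 + 3 * \<theta> / a) ^ N"
proof (induction N arbitrary: E)
  case 0
  then show ?case using card_round_injective_le[of E 0 A] \<open>0 \<le> A\<close> by simp
next
  case (Suc N)
  define h where "h b = (\<Prod>n<N. g (a ^ n * b))" for b
  have mass: "(\<Sum>b | b \<in> E \<and> round (a * b) = k. g b) \<le> 1 + 3 * \<theta> / a" for k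
  proof -
    let ?G = "{b \<in> E. round (a * b) = k}"
    let ?H = "{b \<in> ?G. near_int \<rho> b \<and> near_int \<rho> (a * b)}"
    have sub: "?G \<subseteq> E" "?H \<subseteq> E" by auto
    have fin: "finite ?G" "finite ?H" using Suc.prems(1) sub finite_subset by blast+
    have inj: "inj_on round ?G" using Suc.prems(2) by (rule inj_on_subset) auto
    have near: "\<bar>b - of_int k / a\<bar> \<le> 1 / (2 * a)" if "b \<in> ?G" for b
    proof -
      have "\<bar>a * b - of_int k\<bar> \<le> 1/2"
        using that of_int_round_abs_le[of "a * b"] by (auto simp: abs_minus_commute)
      moreover have "a * b - of_int k = a * (b - of_int k / a)" using a by (simp add: field_simps)
      ultimately have "a * \<bar>b - of_int k / a\<bar> \<le> 1/2" using a(1) by (simp add: abs_mult)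
      then show ?thesis using a(1) by (simp only: pos_le_divide_eq) (simp add: mult.commute)
    qed
    have "real (card ?G) \<le> 2 * (1 / (2 * a)) + 2"
      by (rule card_round_injective_le[OF fin(1) inj near]) (use a in auto)
    also have "\<dots> \<le> 3 / a" using a by (simp add: field_simps)
    finally have cardG: "real (card ?G) \<le> 3 / a" .
    have "round b = round b'" if "b \<in> ?H" "b' \<in> ?H" for b b'
    proof -
      have "round (a * b) = k" "round (a * b') = k" using that by blast+
      then have "round (a * b) = round (a * b')" by (rule trans[OF _ sym])
      then show ?thesis
        using that near_int_predecessor_unique[OF a(1) \<rho>, of b b'] by (simp only: mem_Collect_eq)
    qed
    then have "b = b'" if "b \<in> ?H" "b' \<in> ?H" for b b'
      using that inj unfolding inj_on_def by blast
    then have cardH: "card ?H \<le> 1"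
      unfolding One_nat_def card_le_Suc0_iff_eq[OF fin(2)] by blast
    have "(\<Sum>b\<in>?G. g b) \<le> (\<Sum>b\<in>?G. (if b \<in> ?H then 1 else 0) + \<theta>)"
      using small g(2) \<open>0 \<le> \<theta>\<close> by (intro sum_mono) (auto intro: add_increasing2)
    also have "\<dots> = real (card ?H) + \<theta> * real (card ?G)"
    proof -
      have "?G \<inter> ?H = ?H" by auto
      then have "(\<Sum>b\<in>?G. (if b \<in> ?H then 1 else 0::real)) = real (card ?H)"
        by (simp add: sum.If_cases fin(1) del: mem_Collect_eq)
      then show ?thesis by (simp add: sum.distrib)
    qed
    also have "\<dots> \<le> 1 + \<theta> * (3 / a)"
      using cardH cardG \<open>0 \<le> \<theta>\<close> by (intro add_mono mult_left_mono) auto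
    finally show ?thesis by (simp add: mult.commute)
  qed
  obtain E' where E': "E' \<subseteq> (\<lambda>b. a * b) ` E" "inj_on round E'"
    and le: "(\<Sum>b\<in>E. g b * h (a * b)) \<le> (1 + 3 * \<theta> / a) * (\<Sum>b\<in>E'. h b)"
    using weighted_sum_le_separated_sum[of E g h "\<lambda>b. a * b", OF Suc.prems(1) g(1) _ mass]
    by (auto simp: h_def prod_nonneg g)
  have "(\<Sum>b\<in>E'. h b) \<le> (2 * A + 2) * (1 + 3 * \<theta> / a) ^ N"
    unfolding h_def
  proof (rule Suc.IH[OF _ E'(2)])
    show "finite E'" using E'(1) Suc.prems(1) finite_surj by blast
    show "\<bar>b\<bar> * a ^ N \<le> A" if b: "b \<in> E'" for b
    proof -
      obtain c where "c \<in> E" "b = a * c" using b E'(1) by auto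
      then show ?thesis using Suc.prems(3)[of c] a by (simp add: abs_mult mult_ac)
    qed
  qed
  then have "(1 + 3 * \<theta> / a) * (\<Sum>b\<in>E'. h b) \<le> (2 * A + 2) * (1 + 3 * \<theta> / a) ^ Suc N"
    using a \<open>0 \<le> \<theta>\<close> by (simp add: mult_left_mono mult.left_commute)
  moreover have "(\<Prod>n<Suc N. g (a ^ n * b)) = g b * h (a * b)" for b
    by (simp add: h_def prod.lessThan_Suc_shift mult_ac del: prod.lessThan_Suc)
  ultimately show ?case using le by simp
qed

section \<open>Self-similarity of the measure\<close>

locale homogeneous_ifs =
  fixes a :: real and t p :: "real ^ 'm"
  assumes a_pos: "0 < a" and a_less_1: "a < 1" and prob_p: "probability_vector p"
begin

definition index_law :: "'m measure" where "index_law = point_measure UNIV (\<lambda>i. ennreal (p $ i))"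

definition series :: "(nat \<Rightarrow> 'm) \<Rightarrow> real" where "series w = (\<Sum>n. t $ (w n) * a ^ Suc n)"

abbreviation \<mu> :: "real measure" where "\<mu> \<equiv> self_similar_measure a t p"

definition T :: real where "T = (\<Sum>i\<in>UNIV. \<bar>t $ i\<bar>)"

text \<open>The geometric bound for the series and for each of its partial sums;
\<open>\<mu>\<close> is carried by the interval from \<open>-R\<close> to \<open>R\<close>.\<close>

definition R :: real where "R = T * a / (1 - a)"

lemma p_nonneg: "0 \<le> p $ i" and sum_p: "(\<Sum>i\<in>UNIV. p $ i) = 1"
  using prob_p by (auto simp: probability_vector_def)

lemma prob_space_index_law: "prob_space index_law"
  unfolding index_law_def using p_nonneg sum_p
  by (intro prob_space_point_measure) (auto simp: sum_ennreal)

lemma sequence_space_index_law: "sequence_space index_law"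
  unfolding sequence_space_def product_prob_space_def product_sigma_finite_def
    product_prob_space_axioms_def
  using prob_space_index_law by (auto intro: prob_space_imp_sigma_finite)

abbreviation \<Omega> :: "(nat \<Rightarrow> 'm) measure" where "\<Omega> \<equiv> (\<Pi>\<^sub>M n\<in>(UNIV :: nat set). index_law)"

lemma prob_space_\<Omega>: "prob_space \<Omega>"
  by (intro prob_space_PiM prob_space_index_law)

lemma measurable_index_law: "f \<in> measurable index_law N \<longleftrightarrow> f \<in> UNIV \<rightarrow> space N"
  unfolding index_law_def by (simp add: measurable_point_measure_eq1)

lemma series_measurable [measurable]: "series \<in> borel_measurable \<Omega>"
proof -
  have [measurable]: "(\<lambda>i. t $ i) \<in> borel_measurable index_law" by (simp add: measurable_index_law)
  show ?thesis unfolding series_def by measurable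
qed

lemma \<mu>_eq: "\<mu> = distr \<Omega> borel series"
  unfolding self_similar_measure_def index_law_def series_def ..

lemma prob_space_\<mu>: "prob_space \<mu>"
  unfolding \<mu>_eq using prob_space_\<Omega> by (rule prob_space.prob_space_distr) measurable

lemma sets_\<mu> [measurable_cong, simp]: "sets \<mu> = sets borel" and space_\<mu> [simp]: "space \<mu> = UNIV"
  by (simp_all add: \<mu>_eq)

lemma abs_t_le: "\<bar>t $ i\<bar> \<le> T"
  unfolding T_def by (rule member_le_sum) auto

lemma R_nonneg: "0 \<le> R"
  unfolding T_def R_def using a_pos a_less_1 by (auto intro!: sum_nonneg divide_nonneg_nonneg mult_nonneg_nonneg)

lemma majorant_sums: "(\<lambda>n. T * a ^ Suc n) sums R"
  using sums_mult[OF geometric_sums[of a], of "T * a"] a_pos a_less_1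
  by (simp add: R_def mult_ac)

lemma term_le: "norm (t $ (w n) * a ^ Suc n) \<le> T * a ^ Suc n"
  using a_pos abs_t_le by (simp add: abs_mult mult_right_mono)

lemma summable_series: "summable (\<lambda>n. t $ (w n) * a ^ Suc n)"
  by (rule summable_comparison_test'[OF sums_summable[OF majorant_sums] term_le])

lemma abs_series_le: "\<bar>series w\<bar> \<le> R"
proof -
  have "norm (series w) \<le> (\<Sum>n. T * a ^ Suc n)"
    unfolding series_def by (rule norm_suminf_le[OF term_le sums_summable[OF majorant_sums]])
  then show ?thesis using majorant_sums by (simp add: sums_iff)
qed

lemma AE_support: "AE x in \<mu>. \<bar>x\<bar> \<le> R"
  unfolding \<mu>_eq by (subst AE_distr_iff) (auto simp: abs_series_le)

lemma series_Cons: "series (case_nat i w) = a * (t $ i + series w)"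
proof -
  have "series (case_nat i w) = (\<Sum>n. t $ w n * a ^ Suc (Suc n)) + t $ i * a"
    unfolding series_def using suminf_split_head[OF summable_series[of "case_nat i w"]] by simp
  also have "(\<Sum>n. t $ w n * a ^ Suc (Suc n)) = a * series w"
    unfolding series_def using suminf_mult[OF summable_series[of w], of a] by (simp add: mult_ac)
  finally show ?thesis by (simp add: algebra_simps)
qed

lemma integrable_\<mu>:
  fixes f :: "real \<Rightarrow> 'b::{banach, second_countable_topology}"
  assumes "f \<in> borel_measurable borel" and "\<And>x. norm (f x) \<le> B"
  shows "integrable \<mu> f"
  using assms by (intro finite_measure.integrable_const_bound[OF prob_space.finite_measure[OF prob_space_\<mu>]]) auto

text \<open>Splitting off the first index of an i.i.d. sequence leaves an independent sequence with the
same law, and the series of the whole sequence is \<open>a * (t $ i + x)\<close> where \<open>x\<close> is the series of the tail.\<close>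

lemma integral_self_similar:
  fixes f :: "real \<Rightarrow> 'b::{banach, second_countable_topology}"
  assumes f [measurable]: "f \<in> borel_measurable borel" and bound: "\<And>x. norm (f x) \<le> B"
  shows "(LINT x|\<mu>. f x) = (\<Sum>i\<in>UNIV. p $ i *\<^sub>R (LINT x|\<mu>. f (a * (t $ i + x))))"
proof -
  interpret sequence_space index_law by (rule sequence_space_index_law)
  interpret index_law: prob_space index_law by (rule prob_space_index_law)
  interpret PP: pair_prob_space index_law \<Omega> by unfold_locales
  have [measurable]: "(\<lambda>i. t $ i) \<in> borel_measurable index_law" by (simp add: measurable_index_law)
  have [measurable]: "(\<lambda>(s, \<omega>). case_nat s \<omega>) \<in> measurable (index_law \<Otimes>\<^sub>M \<Omega>) \<Omega>" by measurable
  have "(LINT x|\<mu>. f x) = (LINT w|\<Omega>. f (series w))"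
    unfolding \<mu>_eq by (subst integral_distr) auto
  also have "\<dots> = (LINT w|distr (index_law \<Otimes>\<^sub>M \<Omega>) \<Omega> (\<lambda>(s, \<omega>). case_nat s \<omega>). f (series w))"
    by (simp add: PiM_iter)
  also have "\<dots> = (LINT z|(index_law \<Otimes>\<^sub>M \<Omega>). f (a * (t $ fst z + series (snd z))))"
    by (subst integral_distr) (auto simp: case_prod_unfold series_Cons)
  also have "\<dots> = (LINT i|index_law. LINT w|\<Omega>. f (a * (t $ i + series w)))"
  proof (subst PP.integral_fst'[symmetric])
    show "integrable (index_law \<Otimes>\<^sub>M \<Omega>) (\<lambda>z. f (a * (t $ fst z + series (snd z))))"
      using bound by (intro PP.P.integrable_const_bound[of _ B]) auto
  qed simp
  also have "\<dots> = (\<Sum>i\<in>UNIV. p $ i *\<^sub>R (LINT w|\<Omega>. f (a * (t $ i + series w))))"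
    unfolding index_law_def by (rule lebesgue_integral_point_measure_finite) (auto simp: p_nonneg)
  also have "\<dots> = (\<Sum>i\<in>UNIV. p $ i *\<^sub>R (LINT x|\<mu>. f (a * (t $ i + x))))"
    unfolding \<mu>_eq by (subst integral_distr) auto
  finally show ?thesis .
qed

text \<open>The sum of the first \<open>n\<close> terms of the series has finitely many values. It is represented by the
words of length \<open>n\<close>, so that integrals against its law are finite sums.\<close>

definition words :: "nat \<Rightarrow> 'm list set" where "words n = {w. length w = n}"

definition weight :: "'m list \<Rightarrow> real" where "weight w = (\<Prod>i\<leftarrow>w. p $ i)"

fun offset :: "'m list \<Rightarrow> real" where
  "offset [] = 0"
| "offset (i # w) = a * (t $ i + offset w)"

lemma finite_words: "finite (words n)"
  using finite_lists_length_eq[of "UNIV :: 'm set" n] by (simp add: words_def)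

lemma weight_nonneg: "0 \<le> weight w"
  by (induction w) (auto simp: weight_def p_nonneg)

lemma sum_words_Suc:
  "(\<Sum>w\<in>words (Suc n). f w) = (\<Sum>i\<in>UNIV. \<Sum>w\<in>words n. f (i # w))"
proof -
  have "words (Suc n) = (\<lambda>(i, w). i # w) ` (UNIV \<times> words n)"
    by (auto simp: words_def length_Suc_conv image_iff)
  moreover have "inj_on (\<lambda>(i, w). i # w) (UNIV \<times> words n)" by (auto simp: inj_on_def)
  ultimately show ?thesis
    by (simp add: sum.reindex sum.cartesian_product case_prod_unfold)
qed

lemma sum_weight: "(\<Sum>w\<in>words n. weight w) = 1"
proof (induction n)
  case 0
  show ?case by (simp add: words_def weight_def)
next
  case (Suc n)
  have "(\<Sum>w\<in>words (Suc n). weight w) = (\<Sum>i\<in>UNIV. p $ i * (\<Sum>w\<in>words n. weight w))"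
    by (simp add: sum_words_Suc weight_def sum_distrib_left)
  then show ?case using Suc sum_p by simp
qed

lemma abs_offset_le: "\<bar>offset w\<bar> \<le> R"
proof (induction w)
  case (Cons i w)
  have "\<bar>a * (t $ i + offset w)\<bar> = a * \<bar>t $ i + offset w\<bar>" using a_pos by (simp add: abs_mult)
  also have "\<dots> \<le> a * (T + R)"
    using a_pos Cons.IH abs_t_le[of i] by (intro mult_left_mono) auto
  also have "\<dots> = R" using a_less_1 by (simp add: R_def field_simps)
  finally show ?case by simp
qed (simp add: R_nonneg)

text \<open>The random series is its partial sum of \<open>n\<close> terms plus an independent copy of itself scaled by
\<open>a ^ n\<close>.\<close>

lemma integral_words:
  fixes f :: "real \<Rightarrow> 'b::{banach, second_countable_topology}"
  assumes "f \<in> borel_measurable borel" and "\<And>x. norm (f x) \<le> B"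
  shows "(LINT x|\<mu>. f x) = (\<Sum>w\<in>words n. weight w *\<^sub>R (LINT x|\<mu>. f (offset w + a ^ n * x)))"
  using assms
proof (induction n arbitrary: f)
  case 0
  show ?case by (simp add: words_def weight_def)
next
  case (Suc n)
  note [measurable] = Suc.prems(1)
  have IH: "(LINT x|\<mu>. f (a * (t $ i + x))) =
      (\<Sum>w\<in>words n. weight w *\<^sub>R (LINT x|\<mu>. f (a * (t $ i + (offset w + a ^ n * x)))))" for i
    by (rule Suc.IH) (use Suc.prems(2) in auto)
  have "(LINT x|\<mu>. f x) = (\<Sum>i\<in>UNIV. p $ i *\<^sub>R (LINT x|\<mu>. f (a * (t $ i + x))))"
    using Suc.prems by (rule integral_self_similar)
  also have "\<dots> = (\<Sum>w\<in>words (Suc n). weight w *\<^sub>R (LINT x|\<mu>. f (offset w + a ^ Suc n * x)))"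
    unfolding IH sum_words_Suc
    by (simp add: scaleR_sum_right weight_def algebra_simps)
  finally show ?case .
qed

lemma measure_words:
  assumes "A \<in> sets borel"
  shows "measure \<mu> A = (\<Sum>w\<in>words n. weight w * measure \<mu> {x. offset w + a ^ n * x \<in> A})"
proof -
  have [measurable]: "A \<in> sets borel" by fact
  have "(LINT x|\<mu>. indicator A (offset w + a ^ n * x) :: real) =
      measure \<mu> {x. offset w + a ^ n * x \<in> A}" for w
  proof -
    have "(LINT x|\<mu>. indicator A (offset w + a ^ n * x) :: real) =
        (LINT x|\<mu>. indicator {x. offset w + a ^ n * x \<in> A} x)"
      by (simp add: indicator_def)
    then show ?thesis by simp
  qed
  moreover have "measure \<mu> A = (LINT x|\<mu>. indicator A x :: real)" by simp
  ultimately show ?thesis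
    by (simp only:) (subst integral_words[of _ 1 n], auto simp: indicator_def)
qed

end

section \<open>Unimodular exponentials\<close>

lemma fourier_transform_cis: "fourier_transform M \<xi> = (LINT x|M. cis (2 * pi * \<xi> * x))"
  unfolding fourier_transform_def by (simp add: cis_conv_exp mult_ac)

lemma measurable_cis [measurable]: "cis \<in> borel_measurable borel"
  by (intro borel_measurable_continuous_onI continuous_intros)

lemma norm_cis_diff_le: "norm (cis x - cis y) \<le> \<bar>x - y\<bar>"
proof -
  have "cis x - cis y = cis y * (cis (x - y) - 1)" by (simp add: algebra_simps cis_mult)
  then have "norm (cis x - cis y) = norm (cis (x - y) - 1)" by (simp add: norm_mult)
  also have "\<dots> \<le> \<bar>x - y\<bar>" using iexp_approx1[of "x - y" 0] by (simp add: cis_conv_exp)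
  finally show ?thesis .
qed

text \<open>Strict loss in the triangle inequality for two vectors that point in different directions.\<close>

lemma norm_cis_combination_le:
  assumes "0 \<le> r" "0 \<le> s" "cos (x - y) \<le> c"
  shows "norm (r *\<^sub>R cis x + s *\<^sub>R cis y) \<le> sqrt (r\<^sup>2 + s\<^sup>2 + 2 * r * s * c)"
proof -
  have "(norm (r *\<^sub>R cis x + s *\<^sub>R cis y))\<^sup>2 =
      (r * cos x + s * cos y)\<^sup>2 + (r * sin x + s * sin y)\<^sup>2"
    by (simp add: cmod_power2)
  also have "\<dots> = r\<^sup>2 * ((sin x)\<^sup>2 + (cos x)\<^sup>2) + s\<^sup>2 * ((sin y)\<^sup>2 + (cos y)\<^sup>2)
      + 2 * r * s * (cos x * cos y + sin x * sin y)"
    by algebra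
  also have "\<dots> = r\<^sup>2 + s\<^sup>2 + 2 * r * s * cos (x - y)"
    by (simp add: cos_diff)
  also have "\<dots> \<le> r\<^sup>2 + s\<^sup>2 + 2 * r * s * c"
    using assms by (simp add: mult_left_mono)
  finally show ?thesis by (rule real_le_rsqrt)
qed

lemma cos_le_if_not_near_int:
  assumes "0 < \<rho>" "\<rho> \<le> 1/2" "\<not> near_int \<rho> x"
  shows "cos (2 * pi * x) \<le> cos (2 * pi * \<rho>)"
proof -
  define f where "f = \<bar>x - of_int (round x)\<bar>"
  have f: "\<rho> \<le> f" "f \<le> 1/2"
    using assms(3) of_int_round_abs_le[of x] by (auto simp: near_int_def f_def abs_minus_commute)
  have "cos (2 * pi * x) = cos (2 * pi * (x - of_int (round x)))"
    using cos_int_2pin[of "round x"] sin_int_2pin[of "round x"]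
    by (simp add: right_diff_distrib cos_diff mult_ac)
  also have "\<dots> = cos \<bar>2 * pi * (x - of_int (round x))\<bar>" by simp
  also have "\<dots> = cos (2 * pi * f)" by (simp add: f_def abs_mult)
  also have "\<dots> \<le> cos (2 * pi * \<rho>)"
    using f assms(1) by (intro cos_monotone_0_pi_le) auto
  finally show ?thesis .
qed

context homogeneous_ifs
begin

section \<open>Power decay of the mass of small intervals\<close>

lemma two_translations_if_not_atom:
  assumes "\<nexists>x. \<mu> = return borel x"
  shows "\<exists>i j. 0 < p $ i \<and> 0 < p $ j \<and> t $ i \<noteq> t $ j"
proof (rule ccontr)
  assume "\<not> ?thesis"
  then have same: "t $ i = t $ j" if "0 < p $ i" "0 < p $ j" for i j
    using that by blast
  have "\<exists>i. 0 < p $ i"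
  proof (rule ccontr)
    assume "\<not> ?thesis"
    then have "(\<Sum>i\<in>UNIV. p $ i) \<le> 0" by (intro sum_nonpos) (simp add: not_less)
    then show False using sum_p by simp
  qed
  then obtain i0 where i0: "0 < p $ i0" ..
  define c where "c = (\<Sum>n. t $ i0 * a ^ Suc n)"
  have "AE i in index_law. t $ i = t $ i0"
    unfolding index_law_def AE_point_measure using i0 by (auto intro: same)
  then have "AE w in \<Omega>. t $ w n = t $ i0" for n
    using AE_PiM_component[of UNIV "\<lambda>_. index_law" n "\<lambda>i. t $ i = t $ i0"] prob_space_index_law by simp
  then have "AE w in \<Omega>. \<forall>n. t $ w n = t $ i0"
    by (simp add: AE_all_countable)
  then have "AE w in \<Omega>. series w = c"
    by eventually_elim (simp add: series_def c_def)
  then have "\<mu> = distr \<Omega> borel (\<lambda>_. c)"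
    unfolding \<mu>_eq by (intro distr_cong_AE) auto
  also have "\<dots> = return borel c"
    using prob_space_\<Omega> by (intro prob_space.distr_const) auto
  finally show False using assms by blast
qed

text \<open>Two words that differ only in their first letter have offsets at distance
\<open>a * \<bar>t $ i - t $ j\<bar>\<close>, independent of their length. For long words the two scaled copies of \<open>\<mu>\<close>
around these offsets are much shorter than that distance, so a short ball misses one of them
and loses a fixed proportion of the available mass. The preimages of the ball under the word
maps are again balls, larger by a fixed factor, and the loss can be iterated.\<close>

lemma measure_cball_le_power:
  assumes i: "0 < p $ i" and j: "0 < p $ j" and ne: "t $ i \<noteq> t $ j"
  obtains r0 c \<kappa> where "0 < r0" "0 < c" "c < 1" "0 < \<kappa>" "\<kappa> < 1"
    "\<And>m x r. r \<le> r0 * c ^ m \<Longrightarrow> measure \<mu> (cball x r) \<le> \<kappa> ^ m"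
proof -
  define D where "D = a * \<bar>t $ i - t $ j\<bar>"
  have D: "0 < D" using a_pos ne by (simp add: D_def)
  obtain k where k: "a ^ k * (R + 1) < D / 8"
  proof -
    have "(\<lambda>k. a ^ k * (R + 1)) \<longlonglongrightarrow> 0 * (R + 1)"
      using a_pos a_less_1 by (intro tendsto_intros LIMSEQ_power_zero) auto
    then have "eventually (\<lambda>k. a ^ k * (R + 1) < D / 8) sequentially"
      using D by (intro order_tendstoD(2)[where y = 0]) auto
    then show ?thesis using that by (auto simp: eventually_sequentially)
  qed
  define v where "v = replicate k i"
  define K where "K = Suc k"
  have words: "i # v \<in> words K" "j # v \<in> words K" by (auto simp: words_def v_def K_def)
  have aK: "a ^ K * R \<le> D / 8"
  proof -
    have "a ^ K * R \<le> a ^ k * R"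
      using a_pos a_less_1 R_nonneg by (intro mult_right_mono power_decreasing) (auto simp: K_def)
    also have "\<dots> \<le> a ^ k * (R + 1)" using a_pos by simp
    finally show ?thesis using k by simp
  qed
  \<comment> \<open>The cap at one half keeps the ratio \<open>1 - \<eta>\<close> positive, so that it has a logarithm.\<close>
  define \<eta> where "\<eta> = min (1/2) (min (weight (i # v)) (weight (j # v)))"
  have "0 < weight v" using i by (auto simp: weight_def v_def)
  then have \<eta>: "0 < \<eta>" "\<eta> \<le> 1/2" using i j by (auto simp: \<eta>_def weight_def)
  have "measure \<mu> (cball x r) \<le> (1 - \<eta>) ^ m" if "r \<le> D / 8 * (a ^ K) ^ m" for m x r
    using that
  proof (induction m arbitrary: x r)
    case 0
    show ?case using prob_space.prob_le_1[OF prob_space_\<mu>] by simp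
  next
    case (Suc m)
    let ?A = "\<lambda>w. {z. offset w + a ^ K * z \<in> cball x r}"
    have aKpos: "0 < a ^ K" using a_pos by simp
    have eq: "?A w = cball ((x - offset w) / a ^ K) (r / a ^ K)" for w
    proof -
      have "x - (offset w + a ^ K * z) = a ^ K * ((x - offset w) / a ^ K - z)" for z
        unfolding right_diff_distrib using a_pos by simp
      then have "\<bar>x - (offset w + a ^ K * z)\<bar> = a ^ K * \<bar>(x - offset w) / a ^ K - z\<bar>" for z
        using aKpos by (simp add: abs_mult)
      then show ?thesis using aKpos by (auto simp: dist_real_def pos_le_divide_eq mult.commute)
    qed
    have le: "measure \<mu> (?A w) \<le> (1 - \<eta>) ^ m" for w
      unfolding eq by (rule Suc.IH) (use Suc.prems aKpos in \<open>simp add: pos_divide_le_eq mult_ac\<close>)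
    have "r \<le> D / 8"
    proof -
      have "(a ^ K) ^ Suc m \<le> 1" using a_pos a_less_1 by (intro power_le_one) auto
      then have "D / 8 * (a ^ K) ^ Suc m \<le> D / 8 * 1" using D by (intro mult_left_mono) auto
      then show ?thesis using Suc.prems by linarith
    qed
    have "measure \<mu> (?A (i # v)) = 0 \<or> measure \<mu> (?A (j # v)) = 0"
    proof -
      have zero: "measure \<mu> (?A w) = 0" if "\<And>z. \<bar>z\<bar> \<le> R \<Longrightarrow> z \<notin> ?A w" for w
      proof -
        have "AE z in \<mu>. z \<notin> ?A w" using AE_support by eventually_elim (use that in blast)
        moreover have "?A w \<in> sets \<mu>" unfolding eq by simp
        ultimately show ?thesis
          by (simp add: AE_iff_measurable[OF _ refl] measure_def)
      qed
      have False if z: "\<bar>z\<bar> \<le> R" "z \<in> ?A (i # v)" and z': "\<bar>z'\<bar> \<le> R" "z' \<in> ?A (j # v)" for z z'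
      proof -
        have small: "\<bar>a ^ K * y\<bar> \<le> D / 8" if "\<bar>y\<bar> \<le> R" for y
        proof -
          have "\<bar>a ^ K * y\<bar> \<le> a ^ K * R"
            unfolding abs_mult using that aKpos by (intro mult_mono) auto
          then show ?thesis using aK by linarith
        qed
        have "\<bar>a ^ K * z\<bar> \<le> D / 8" "\<bar>a ^ K * z'\<bar> \<le> D / 8"
          using z(1) z'(1) by (blast intro: small)+
        moreover have "\<bar>x - (offset (i # v) + a ^ K * z)\<bar> \<le> D / 8" "\<bar>x - (offset (j # v) + a ^ K * z')\<bar> \<le> D / 8"
          using z(2) z'(2) \<open>r \<le> D / 8\<close> by (auto simp: dist_real_def)
        moreover have "\<bar>offset (i # v) - offset (j # v)\<bar> = D"
          using a_pos by (simp add: D_def abs_mult flip: right_diff_distrib)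
        ultimately show False using D by linarith
      qed
      then show ?thesis using zero by blast
    qed
    then obtain w0 where w0: "w0 \<in> words K" "\<eta> \<le> weight w0" "measure \<mu> (?A w0) = 0"
      using words by (auto simp: \<eta>_def)
    have "measure \<mu> (cball x r) = (\<Sum>w\<in>words K. weight w * measure \<mu> (?A w))"
      by (rule measure_words) simp
    also have "\<dots> = (\<Sum>w\<in>words K - {w0}. weight w * measure \<mu> (?A w))"
      using w0(3) by (subst sum.remove[OF finite_words w0(1)]) simp
    also have "\<dots> \<le> (\<Sum>w\<in>words K - {w0}. weight w * (1 - \<eta>) ^ m)"
      using le weight_nonneg by (intro sum_mono mult_left_mono) auto
    also have "\<dots> = (1 - weight w0) * (1 - \<eta>) ^ m"
      using sum_weight[of K] sum.remove[OF finite_words w0(1), of weight] by (simp flip: sum_distrib_right)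
    also have "\<dots> \<le> (1 - \<eta>) ^ Suc m"
      using w0(2) \<eta> by (simp add: mult_right_mono)
    finally show ?case .
  qed
  then show ?thesis
    using D \<eta> a_pos a_less_1 by (intro that[of "D / 8" "a ^ K" "1 - \<eta>"]) (auto simp: K_def power_less_one_iff simp del: power_Suc)
qed

text \<open>The preceding geometric decay, read at the scale of \<open>r\<close>, is a Frostman condition.\<close>

lemma measure_cball_le_powr:
  assumes "0 < p $ i" "0 < p $ j" "t $ i \<noteq> t $ j"
  obtains s C where "0 < s" "0 < C" "\<And>x r. 0 < r \<Longrightarrow> measure \<mu> (cball x r) \<le> C * r powr s"
proof -
  obtain r0 c \<kappa> where r0: "0 < r0" and c: "0 < c" "c < 1" and \<kappa>: "0 < \<kappa>" "\<kappa> < 1"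
    and bound: "\<And>m x r. r \<le> r0 * c ^ m \<Longrightarrow> measure \<mu> (cball x r) \<le> \<kappa> ^ m"
    using measure_cball_le_power[OF assms] by metis
  define s where "s = log c \<kappa>"
  have s: "0 < s" using c \<kappa> by (simp add: s_def log_def divide_neg_neg)
  have cs: "c powr s = \<kappa>" using c \<kappa> by (simp add: s_def)
  have "measure \<mu> (cball x r) \<le> 1 / (\<kappa> * r0 powr s) * r powr s" if r: "0 < r" for x r
  proof -
    have "\<exists>m. measure \<mu> (cball x r) \<le> \<kappa> ^ m \<and> r0 * c ^ Suc m \<le> r"
    proof (cases "r \<le> r0")
      case True
      have "\<exists>m. r0 * c ^ m < r"
      proof -
        obtain m where "c ^ m < r / r0" using real_arch_pow_inv[of "r / r0" c] r r0 c by auto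
        then show ?thesis using r0 by (auto simp: field_simps)
      qed
      moreover define m where "m = (LEAST m. r0 * c ^ m < r)"
      ultimately have m: "r0 * c ^ m < r" by (metis LeastI)
      then have "m \<noteq> 0" using True by (intro notI) simp
      then obtain m' where m': "m = Suc m'" by (cases m) auto
      then have "\<not> r0 * c ^ m' < r" using not_less_Least[of m' "\<lambda>m. r0 * c ^ m < r"] by (simp add: m_def)
      then show ?thesis using bound[of r m' x] m m' by (intro exI[of _ m']) auto
    next
      case False
      have "r0 * c \<le> r0 * 1" using r0 c by (intro mult_left_mono) auto
      then show ?thesis using False prob_space.prob_le_1[OF prob_space_\<mu>] by (intro exI[of _ 0]) auto
    qed
    then obtain m where m: "measure \<mu> (cball x r) \<le> \<kappa> ^ m" "r0 * c ^ Suc m \<le> r" by blast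
    have "\<kappa> ^ Suc m = (c ^ Suc m) powr s"
      using cs c \<kappa> by (simp add: powr_powr powr_realpow[symmetric] powr_mult mult_ac add.commute del: power_Suc flip: cs)
    also have "\<dots> \<le> (r / r0) powr s"
      using m(2) r0 c s by (intro powr_mono2) (auto simp: field_simps)
    finally have "\<kappa> ^ m \<le> r powr s / (\<kappa> * r0 powr s)"
      using \<kappa> r r0 by (simp add: powr_divide field_simps)
    then show ?thesis using m(1) by simp
  qed
  moreover have "0 < 1 / (\<kappa> * r0 powr s)" using \<kappa> r0 by simp
  ultimately show ?thesis using s that by blast
qed

section \<open>The infinite product for the Fourier transform\<close>

text \<open>The characteristic function of a single translation \<open>t $ i\<close>, the factor of the infinite product.\<close>

definition \<phi> :: "real \<Rightarrow> complex" where "\<phi> \<xi> = (\<Sum>i\<in>UNIV. p $ i *\<^sub>R cis (2 * pi * \<xi> * t $ i))"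

lemma norm_\<phi>_le_1: "norm (\<phi> \<xi>) \<le> 1"
proof -
  have "norm (\<phi> \<xi>) \<le> (\<Sum>i\<in>UNIV. norm (p $ i *\<^sub>R cis (2 * pi * \<xi> * t $ i)))"
    unfolding \<phi>_def by (rule norm_sum)
  then show ?thesis using sum_p p_nonneg by simp
qed

lemma fourier_\<mu>_step: "fourier_transform \<mu> \<xi> = \<phi> (a * \<xi>) * fourier_transform \<mu> (a * \<xi>)"
proof -
  have shift: "(LINT x|\<mu>. cis (2 * pi * \<xi> * (a * (t $ i + x)))) =
      cis (2 * pi * (a * \<xi>) * t $ i) * fourier_transform \<mu> (a * \<xi>)" for i
    unfolding fourier_transform_cis integral_mult_right_zero[symmetric] cis_mult
    by (simp add: algebra_simps)
  have "fourier_transform \<mu> \<xi> = (\<Sum>i\<in>UNIV. p $ i *\<^sub>R (LINT x|\<mu>. cis (2 * pi * \<xi> * (a * (t $ i + x)))))"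
    unfolding fourier_transform_cis by (intro integral_self_similar[where B = 1]) auto
  also have "\<dots> = (\<Sum>i\<in>UNIV. p $ i *\<^sub>R (cis (2 * pi * (a * \<xi>) * t $ i) * fourier_transform \<mu> (a * \<xi>)))"
    unfolding shift ..
  finally show ?thesis by (simp add: \<phi>_def sum_distrib_right)
qed

lemma norm_fourier_\<mu>_le_1: "norm (fourier_transform \<mu> \<xi>) \<le> 1"
proof -
  have "norm (fourier_transform \<mu> \<xi>) \<le> (LINT x|\<mu>. norm (cis (2 * pi * \<xi> * x)))"
    unfolding fourier_transform_cis by (rule integral_norm_bound)
  then show ?thesis using prob_space.prob_space[OF prob_space_\<mu>] by simp
qed

text \<open>Factors of two consecutive scales are paired because \<open>near_int_predecessor_unique\<close> needs
closeness to the integers at both. Pairing uses up every factor twice, hence the square.\<close>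

lemma norm_fourier_\<mu>_square_le:
  "(norm (fourier_transform \<mu> \<xi>))\<^sup>2 \<le> (\<Prod>n<N. norm (\<phi> (a ^ Suc n * \<xi>)) * norm (\<phi> (a ^ Suc (Suc n) * \<xi>)))"
proof -
  define M where "M \<xi> = norm (fourier_transform \<mu> \<xi>) * norm (fourier_transform \<mu> (a * \<xi>))" for \<xi>
  have "(norm (fourier_transform \<mu> \<xi>))\<^sup>2 \<le> M \<xi>"
  proof -
    have "norm (fourier_transform \<mu> \<xi>) \<le> norm (fourier_transform \<mu> (a * \<xi>))"
      using norm_\<phi>_le_1[of "a * \<xi>"] by (subst fourier_\<mu>_step) (simp add: norm_mult mult_left_le_one_le)
    then show ?thesis by (simp add: M_def power2_eq_square mult_left_mono)
  qed
  also have "M \<xi> \<le> (\<Prod>n<N. norm (\<phi> (a ^ Suc n * \<xi>)) * norm (\<phi> (a ^ Suc (Suc n) * \<xi>)))"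
  proof (induction N arbitrary: \<xi>)
    case 0
    show ?case using norm_fourier_\<mu>_le_1 by (simp add: M_def mult_le_one)
  next
    case (Suc N)
    have "M \<xi> = norm (\<phi> (a * \<xi>)) * norm (\<phi> (a * (a * \<xi>))) * M (a * \<xi>)"
      using fourier_\<mu>_step[of \<xi>] fourier_\<mu>_step[of "a * \<xi>"] by (simp add: M_def norm_mult mult_ac)
    also have "\<dots> \<le> norm (\<phi> (a * \<xi>)) * norm (\<phi> (a * (a * \<xi>))) *
        (\<Prod>n<N. norm (\<phi> (a ^ Suc n * (a * \<xi>))) * norm (\<phi> (a ^ Suc (Suc n) * (a * \<xi>))))"
      by (intro mult_left_mono Suc.IH) auto
    also have "\<dots> = (\<Prod>n<Suc N. norm (\<phi> (a ^ Suc n * \<xi>)) * norm (\<phi> (a ^ Suc (Suc n) * \<xi>)))"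
      unfolding prod.lessThan_Suc_shift by (simp add: power_Suc2 mult.assoc del: power_Suc)
    finally show ?case .
  qed
  finally show ?thesis .
qed

text \<open>The two unit vectors in \<open>\<phi> \<xi>\<close> that belong to \<open>t $ i\<close> and \<open>t $ j\<close> enclose the angle
\<open>2 * pi * \<xi> * (t $ i - t $ j)\<close>. Unless this is close to a full turn, they partly cancel.\<close>

lemma \<phi>_bound_off_lattice:
  assumes p: "0 < p $ i" "0 < p $ j" and ne: "t $ i \<noteq> t $ j" and \<rho>: "0 < \<rho>" "\<rho> < 1/2"
  obtains \<kappa> where "0 < \<kappa>" "\<kappa> < 1" "\<And>\<xi>. \<not> near_int \<rho> (\<xi> * (t $ i - t $ j)) \<Longrightarrow> norm (\<phi> \<xi>) \<le> \<kappa>"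
proof -
  define s where "s = sqrt ((p $ i)\<^sup>2 + (p $ j)\<^sup>2 + 2 * p $ i * p $ j * cos (2 * pi * \<rho>))"
  have "cos (2 * pi * \<rho>) < cos 0" using \<rho> by (intro cos_monotone_0_pi) auto
  then have "2 * p $ i * p $ j * cos (2 * pi * \<rho>) < 2 * p $ i * p $ j * 1"
    using p by (intro mult_strict_left_mono) auto
  then have "s < sqrt ((p $ i + p $ j)\<^sup>2)"
    unfolding s_def by (intro real_sqrt_less_mono) (simp add: power2_sum)
  then have s: "s < p $ i + p $ j" using p by simp
  have ij: "i \<noteq> j" using ne by auto
  let ?rest = "UNIV - {i, j}"
  have split: "(\<Sum>k\<in>UNIV. f k) = f i + f j + (\<Sum>k\<in>?rest. f k)" for f :: "'m \<Rightarrow> 'z::comm_monoid_add"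
  proof -
    have "(\<Sum>k\<in>UNIV. f k) = f i + (\<Sum>k\<in>UNIV - {i}. f k)" by (rule sum.remove) auto
    also have "(\<Sum>k\<in>UNIV - {i}. f k) = f j + (\<Sum>k\<in>UNIV - {i} - {j}. f k)"
      using ij by (intro sum.remove) auto
    also have "UNIV - {i} - {j} = ?rest" by blast
    finally show ?thesis by (simp only: add.assoc)
  qed
  \<comment> \<open>The maximum with one half only ensures positivity.\<close>
  define \<kappa> where "\<kappa> = max (1/2) ((\<Sum>k\<in>?rest. p $ k) + s)"
  have "norm (\<phi> \<xi>) \<le> \<kappa>" if far: "\<not> near_int \<rho> (\<xi> * (t $ i - t $ j))" for \<xi>
  proof -
    let ?c = "\<lambda>k. p $ k *\<^sub>R cis (2 * pi * \<xi> * t $ k)"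
    have "norm (\<phi> \<xi>) \<le> norm (?c i + ?c j) + norm (\<Sum>k\<in>?rest. ?c k)"
      unfolding \<phi>_def split by (rule norm_triangle_ineq)
    also have "norm (\<Sum>k\<in>?rest. ?c k) \<le> (\<Sum>k\<in>?rest. p $ k)"
      using p_nonneg by (intro sum_norm_le) simp
    also have "norm (?c i + ?c j) \<le> s"
      unfolding s_def
    proof (rule norm_cis_combination_le)
      show "cos (2 * pi * \<xi> * t $ i - 2 * pi * \<xi> * t $ j) \<le> cos (2 * pi * \<rho>)"
        using cos_le_if_not_near_int[OF _ _ far] \<rho> by (simp add: algebra_simps)
    qed (use p in auto)
    finally show ?thesis by (simp add: \<kappa>_def)
  qed
  moreover have "\<kappa> < 1" using s split[of "\<lambda>k. p $ k"] sum_p by (simp add: \<kappa>_def)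
  moreover have "0 < \<kappa>" by (simp add: \<kappa>_def)
  ultimately show ?thesis by (intro that) auto
qed

end

section \<open>Linearisation of a convex function\<close>

text \<open>On a compact interval the second derivative is bounded and, by continuity and positivity,
bounded away from zero. The latter makes the derivative expand distances; it is the only way
in which convexity enters.\<close>

lemma C2_convex_bounds:
  assumes C2: "C2 F" and pos: "\<forall>x. deriv (deriv F) x > 0" and B: "0 \<le> B"
  obtains c M where "0 < c" "0 < M" "\<And>x. \<bar>x\<bar> \<le> B \<Longrightarrow> \<bar>deriv F x\<bar> \<le> M"
    "\<And>x y. \<bar>x\<bar> \<le> B \<Longrightarrow> \<bar>y\<bar> \<le> B \<Longrightarrow> c * \<bar>x - y\<bar> \<le> \<bar>deriv F x - deriv F y\<bar>"
    "\<And>x y. \<bar>x\<bar> \<le> B \<Longrightarrow> \<bar>y\<bar> \<le> B \<Longrightarrow> \<bar>F x - (F y + deriv F y * (x - y))\<bar> \<le> M * (x - y)\<^sup>2"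
proof -
  define F1 F2 where "F1 = deriv F" and "F2 = deriv F1"
  have F1: "(F has_real_derivative F1 x) (at x)" and F2: "(F1 has_real_derivative F2 x) (at x)" for x
    using C2 by (auto simp: C2_def F1_def F2_def differentiable_on_def DERIV_deriv_iff_real_differentiable)
  let ?I = "{-B..B}"
  have cont2: "continuous_on ?I F2"
    using C2 unfolding C2_def F1_def F2_def by (auto intro: continuous_on_subset)
  have cont1: "continuous_on ?I F1"
    using F2 by (intro continuous_at_imp_continuous_on) (auto intro: DERIV_isCont)
  have I: "compact ?I" "?I \<noteq> {}" using B by auto
  obtain x0 where x0: "\<forall>x\<in>?I. F2 x0 \<le> F2 x" using continuous_attains_inf[OF I cont2] by blast
  obtain x1 where x1: "\<forall>x\<in>?I. F2 x \<le> F2 x1" using continuous_attains_sup[OF I cont2] by blast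
  obtain M1 where M1: "\<forall>x\<in>?I. \<bar>F1 x\<bar> \<le> M1"
    using compact_continuous_image[OF cont1 I(1)] by (auto dest!: compact_imp_bounded simp: bounded_iff)
  define c where "c = F2 x0"
  define M where "M = max (F2 x1) M1"
  have c: "0 < c" and posM: "0 < M" using pos by (auto simp: c_def M_def F1_def F2_def less_max_iff_disj)
  have mvt: "\<exists>z. \<bar>z\<bar> \<le> B \<and> \<bar>z - y\<bar> \<le> \<bar>x - y\<bar> \<and> f x - f y = f' z * (x - y)"
    if xy: "\<bar>x\<bar> \<le> B" "\<bar>y\<bar> \<le> B" and f: "\<And>z. (f has_real_derivative f' z) (at z)" for x y f f'
  proof -
    consider "x < y" | "x = y" | "y < x" by linarith
    then show ?thesis
    proof cases
      case 1
      obtain z where "x < z" "z < y" "f y - f x = (y - x) * f' z" using MVT2[OF 1 f] by blast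
      then show ?thesis using xy by (intro exI[of _ z]) (auto simp: algebra_simps)
    next
      case 2
      then show ?thesis using xy by (intro exI[of _ x]) auto
    next
      case 3
      obtain z where "y < z" "z < x" "f x - f y = (x - y) * f' z" using MVT2[OF 3 f] by blast
      then show ?thesis using xy by (intro exI[of _ z]) (auto simp: algebra_simps)
    qed
  qed
  have bounds: "c \<le> F2 z" "\<bar>F2 z\<bar> \<le> M" "\<bar>F1 z\<bar> \<le> M" if "\<bar>z\<bar> \<le> B" for z
  proof -
    have z: "z \<in> ?I" using that by auto
    show "c \<le> F2 z" using x0 z by (auto simp: c_def)
    moreover have "F2 z \<le> M" using x1 z by (auto simp: M_def intro: max.coboundedI1)
    ultimately show "\<bar>F2 z\<bar> \<le> M" using c by simp
    show "\<bar>F1 z\<bar> \<le> M" using M1 z by (auto simp: M_def intro: max.coboundedI2)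
  qed
  have lower: "c * \<bar>x - y\<bar> \<le> \<bar>F1 x - F1 y\<bar>" if xy: "\<bar>x\<bar> \<le> B" "\<bar>y\<bar> \<le> B" for x y
  proof -
    obtain z where z: "\<bar>z\<bar> \<le> B" "F1 x - F1 y = F2 z * (x - y)" using mvt[OF xy F2] by blast
    then have "c * \<bar>x - y\<bar> \<le> \<bar>F2 z\<bar> * \<bar>x - y\<bar>" using bounds(1)[OF z(1)] by (intro mult_right_mono) auto
    then show ?thesis using z(2) by (simp add: abs_mult)
  qed
  have taylor: "\<bar>F x - (F y + F1 y * (x - y))\<bar> \<le> M * (x - y)\<^sup>2" if xy: "\<bar>x\<bar> \<le> B" "\<bar>y\<bar> \<le> B" for x y
  proof -
    obtain z where z: "\<bar>z\<bar> \<le> B" "\<bar>z - y\<bar> \<le> \<bar>x - y\<bar>" "F x - F y = F1 z * (x - y)"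
      using mvt[OF xy F1] by blast
    obtain z' where z': "\<bar>z'\<bar> \<le> B" "F1 z - F1 y = F2 z' * (z - y)"
      using mvt[OF z(1) xy(2) F2] by blast
    have "F x - (F y + F1 y * (x - y)) = (F1 z - F1 y) * (x - y)"
      using z(3) by (simp add: algebra_simps)
    then have "\<bar>F x - (F y + F1 y * (x - y))\<bar> = \<bar>F2 z'\<bar> * \<bar>z - y\<bar> * \<bar>x - y\<bar>"
      using z'(2) by (simp add: abs_mult)
    also have "\<dots> \<le> M * \<bar>x - y\<bar> * \<bar>x - y\<bar>"
      using z(2) bounds(2)[OF z'(1)] posM by (intro mult_right_mono mult_mono) auto
    finally show ?thesis by (simp add: power2_eq_square mult.assoc)
  qed
  show ?thesis
    using that[OF c posM bounds(3)[unfolded F1_def] lower[unfolded F1_def] taylor[unfolded F1_def]] by blast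
qed

context homogeneous_ifs
begin

section \<open>Sparsity of the frequencies with a large transform\<close>

text \<open>With a large exponent every factor that is bounded by some \<open>\<kappa> < 1\<close> becomes as small as desired,
so \<open>sum_lacunary_products_le\<close> applies with a growth rate as near to 1 as desired. The numbers
\<open>b\<close> are frequencies, rescaled such that the critical lattice of \<open>\<phi>\<close> becomes the integers.\<close>

lemma fourier_moment_bound:
  assumes ij: "0 < p $ i" "0 < p $ j" "t $ i \<noteq> t $ j" and \<delta>: "0 < \<delta>"
  shows "\<exists>Q>0. \<forall>E A N. finite E \<and> inj_on round E \<and> 0 \<le> A \<and> (\<forall>b\<in>E. \<bar>b\<bar> * a ^ N \<le> A) \<longrightarrow>
    (\<Sum>b\<in>E. norm (fourier_transform \<mu> (b / (a * (t $ i - t $ j)))) ^ Q) \<le> (2 * A + 2) * (1 + \<delta>) ^ N"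
proof -
  define d where "d = t $ i - t $ j"
  have d: "d \<noteq> 0" using ij by (simp add: d_def)
  \<comment> \<open>The largest value that \<open>near_int_predecessor_unique\<close> admits.\<close>
  define \<rho> where "\<rho> = a / (2 * (1 + a))"
  have \<rho>: "0 < \<rho>" "\<rho> < 1/2" "\<rho> * (1 + a) \<le> a / 2"
    using a_pos a_less_1 by (auto simp: \<rho>_def field_simps)
  obtain \<kappa> where \<kappa>: "0 < \<kappa>" "\<kappa> < 1" and off: "\<And>\<xi>. \<not> near_int \<rho> (\<xi> * d) \<Longrightarrow> norm (\<phi> \<xi>) \<le> \<kappa>"
    using \<phi>_bound_off_lattice[OF ij \<rho>(1,2)] unfolding d_def by metis
  obtain q0 where q0: "\<kappa> ^ q0 < \<delta> * a / 3"
    using real_arch_pow_inv[of "\<delta> * a / 3" \<kappa>] \<delta> a_pos \<kappa> by auto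
  \<comment> \<open>The successor makes the exponent \<open>Q\<close> positive even if \<open>q0 = 0\<close>.\<close>
  define \<theta> where "\<theta> = \<kappa> ^ Suc q0"
  have "\<kappa> ^ Suc q0 \<le> \<kappa> ^ q0" using \<kappa> by (intro power_decreasing) auto
  then have "3 * \<theta> \<le> \<delta> * a" using q0 unfolding \<theta>_def by linarith
  then have \<theta>: "0 \<le> \<theta>" "3 * \<theta> / a \<le> \<delta>" using \<kappa> a_pos by (auto simp: \<theta>_def pos_divide_le_eq)
  define g where "g b = (norm (\<phi> (b / d)) * norm (\<phi> (a * b / d))) ^ Suc q0" for b
  define Q where "Q = 2 * Suc q0"
  have prod_le_1: "norm (\<phi> x) * norm (\<phi> y) \<le> 1" for x y
    using norm_\<phi>_le_1 by (intro mult_le_one) auto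
  have g: "0 \<le> g b" "g b \<le> 1" for b
    unfolding g_def using prod_le_1 by (auto simp del: power_Suc intro!: power_le_one)
  have small: "g b \<le> \<theta>" if "\<not> (near_int \<rho> b \<and> near_int \<rho> (a * b))" for b
  proof -
    have "norm (\<phi> (b / d)) \<le> \<kappa> \<or> norm (\<phi> (a * b / d)) \<le> \<kappa>"
      using that off[of "b / d"] off[of "a * b / d"] d by auto
    then have "norm (\<phi> (b / d)) * norm (\<phi> (a * b / d)) \<le> \<kappa>"
    proof
      assume "norm (\<phi> (b / d)) \<le> \<kappa>"
      then show ?thesis using norm_\<phi>_le_1[of "a * b / d"] \<kappa>
        mult_mono[of "norm (\<phi> (b / d))" \<kappa> "norm (\<phi> (a * b / d))" 1] by simp
    next
      assume "norm (\<phi> (a * b / d)) \<le> \<kappa>"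
      then show ?thesis using norm_\<phi>_le_1[of "b / d"] \<kappa>
        mult_mono[of "norm (\<phi> (b / d))" 1 "norm (\<phi> (a * b / d))" \<kappa>] by simp
    qed
    then show ?thesis unfolding g_def \<theta>_def by (intro power_mono) auto
  qed
  have pointwise: "norm (fourier_transform \<mu> (b / (a * d))) ^ Q \<le> (\<Prod>n<N. g (a ^ n * b))" for b N
  proof -
    let ?x = "b / (a * d)"
    have "norm (fourier_transform \<mu> ?x) ^ Q = ((norm (fourier_transform \<mu> ?x))\<^sup>2) ^ Suc q0"
      unfolding Q_def power_mult ..
    also have "\<dots> \<le> (\<Prod>n<N. norm (\<phi> (a ^ Suc n * ?x)) * norm (\<phi> (a ^ Suc (Suc n) * ?x))) ^ Suc q0"
      by (intro power_mono norm_fourier_\<mu>_square_le zero_le_power2)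
    also have "\<dots> = (\<Prod>n<N. g (a ^ n * b))"
    proof -
      have "a ^ Suc n * ?x = a ^ n * b / d" "a ^ Suc (Suc n) * ?x = a * (a ^ n * b) / d" for n
        using a_pos d by (auto simp: field_simps)
      then show ?thesis unfolding g_def prod_power_distrib by simp
    qed
    finally show ?thesis .
  qed
  have "(\<Sum>b\<in>E. norm (fourier_transform \<mu> (b / (a * d))) ^ Q) \<le> (2 * A + 2) * (1 + \<delta>) ^ N"
    if E: "finite E" "inj_on round E" and A: "0 \<le> A" and size: "\<forall>b\<in>E. \<bar>b\<bar> * a ^ N \<le> A" for E A N
  proof -
    have "(\<Sum>b\<in>E. norm (fourier_transform \<mu> (b / (a * d))) ^ Q) \<le> (\<Sum>b\<in>E. \<Prod>n<N. g (a ^ n * b))"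
      using pointwise by (rule sum_mono)
    also have "\<dots> \<le> (2 * A + 2) * (1 + 3 * \<theta> / a) ^ N"
      by (rule sum_lacunary_products_le[OF a_pos a_less_1 \<rho>(3) \<theta>(1) g small A E]) (use size in auto)
    also have "\<dots> \<le> (2 * A + 2) * (1 + \<delta>) ^ N"
      using \<theta> A a_pos by (intro mult_left_mono power_mono) auto
    finally show ?thesis .
  qed
  moreover have "0 < Q" by (simp add: Q_def)
  ultimately show ?thesis unfolding d_def by blast
qed

section \<open>Fourier decay of the image measure\<close>

text \<open>The weight of the words with offset near \<open>x\<close> is a mass of the discretised measure; the full
measure has at least this mass in a ball enlarged by the radius of the scaled copies.\<close>

lemma sum_weight_near_le:
  "(\<Sum>w | w \<in> words n \<and> \<bar>x - offset w\<bar> \<le> r. weight w) \<le> measure \<mu> (cball x (r + a ^ n * R))"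
proof -
  let ?B = "cball x (r + a ^ n * R)"
  let ?A = "\<lambda>w. {z. offset w + a ^ n * z \<in> ?B}"
  have full: "measure \<mu> (?A w) = 1" if "\<bar>x - offset w\<bar> \<le> r" for w
  proof -
    have "AE z in \<mu>. z \<in> ?A w"
      using AE_support
    proof eventually_elim
      case (elim z)
      have "\<bar>a ^ n * z\<bar> \<le> a ^ n * R" using elim a_pos by (simp add: abs_mult)
      then show ?case using that by (auto simp: dist_real_def)
    qed
    moreover have "?A w \<in> sets borel" unfolding mem_cball dist_real_def by measurable
    ultimately show ?thesis using prob_space.prob_eq_1[OF prob_space_\<mu>, of "?A w"] by simp
  qed
  have "(\<Sum>w | w \<in> words n \<and> \<bar>x - offset w\<bar> \<le> r. weight w) =
      (\<Sum>w | w \<in> words n \<and> \<bar>x - offset w\<bar> \<le> r. weight w * measure \<mu> (?A w))"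
    by (intro sum.cong refl) (simp only: mem_Collect_eq full mult_1_right)
  also have "\<dots> \<le> (\<Sum>w\<in>words n. weight w * measure \<mu> (?A w))"
    using finite_words weight_nonneg by (intro sum_mono2) auto
  also have "\<dots> = measure \<mu> ?B"
    by (rule measure_words[symmetric]) simp
  finally show ?thesis .
qed

text \<open>On each scaled copy of \<open>\<mu>\<close>, of size \<open>a ^ n\<close>, replace \<open>F\<close> by its tangent. The integral over the
copy turns into the transform of \<open>\<mu>\<close> itself at a frequency proportional to the slope, with an
error from the quadratic remainder.\<close>

lemma fourier_image_linearised:
  assumes F: "continuous_on UNIV F"
    and taylor: "\<And>x y. \<bar>x\<bar> \<le> 2 * R \<Longrightarrow> \<bar>y\<bar> \<le> 2 * R \<Longrightarrow> \<bar>F x - (F y + F' y * (x - y))\<bar> \<le> M * (x - y)\<^sup>2"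
    and M: "0 \<le> M"
  shows "norm (fourier_transform (distr \<mu> borel F) u) \<le>
    (\<Sum>w\<in>words n. weight w * norm (fourier_transform \<mu> (u * a ^ n * F' (offset w))))
      + 2 * pi * M * R\<^sup>2 * (\<bar>u\<bar> * (a ^ n)\<^sup>2)"
proof -
  have [measurable]: "F \<in> borel_measurable borel" using F by (rule borel_measurable_continuous_onI)
  let ?err = "2 * pi * M * R\<^sup>2 * (\<bar>u\<bar> * (a ^ n)\<^sup>2)"
  let ?f = "\<lambda>w x. cis (2 * pi * u * F (offset w + a ^ n * x))"
  let ?g = "\<lambda>w x. cis (2 * pi * u * (F (offset w) + F' (offset w) * (a ^ n * x)))"
  have piece: "norm (LINT x|\<mu>. ?f w x) \<le> norm (fourier_transform \<mu> (u * a ^ n * F' (offset w))) + ?err" for w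
  proof -
    have int: "integrable \<mu> (?f w)" "integrable \<mu> (?g w)" by (rule integrable_\<mu>[of _ 1]; simp)+
    have "AE x in \<mu>. norm (?f w x - ?g w x) \<le> ?err"
      using AE_support
    proof eventually_elim
      case (elim x)
      let ?y = "offset w + a ^ n * x"
      have an: "0 < a ^ n" "a ^ n \<le> 1" using a_pos a_less_1 by (auto intro: power_le_one)
      have "\<bar>a ^ n * x\<bar> \<le> 1 * R" unfolding abs_mult using elim an by (intro mult_mono) auto
      then have y: "\<bar>?y\<bar> \<le> 2 * R" using abs_offset_le[of w] by linarith
      have o: "\<bar>offset w\<bar> \<le> 2 * R" using abs_offset_le[of w] by linarith
      have "norm (?f w x - ?g w x) \<le> \<bar>2 * pi * u * F ?y - 2 * pi * u * (F (offset w) + F' (offset w) * (a ^ n * x))\<bar>"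
        by (rule norm_cis_diff_le)
      also have "\<dots> = 2 * pi * \<bar>u\<bar> * \<bar>F ?y - (F (offset w) + F' (offset w) * (?y - offset w))\<bar>"
        unfolding right_diff_distrib[symmetric] abs_mult by simp
      also have "\<dots> \<le> 2 * pi * \<bar>u\<bar> * (M * (?y - offset w)\<^sup>2)"
        using taylor[OF y o] by (intro mult_left_mono) auto
      also have "\<dots> = 2 * pi * \<bar>u\<bar> * M * (a ^ n)\<^sup>2 * \<bar>x\<bar>\<^sup>2"
        by (simp add: power_mult_distrib)
      also have "\<dots> \<le> 2 * pi * \<bar>u\<bar> * M * (a ^ n)\<^sup>2 * R\<^sup>2"
        using elim M by (intro mult_left_mono power_mono) auto
      finally show ?case by (simp add: mult_ac)
    qed
    then have "norm (LINT x|\<mu>. ?f w x - ?g w x) \<le> ?err"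
      using int by (intro order_trans[OF integral_norm_bound] prob_space.integral_le_const[OF prob_space_\<mu>]) auto
    moreover have "(LINT x|\<mu>. ?g w x) =
        cis (2 * pi * u * F (offset w)) * fourier_transform \<mu> (u * a ^ n * F' (offset w))"
      unfolding fourier_transform_cis integral_mult_right_zero[symmetric] cis_mult
      by (simp add: algebra_simps)
    then have "norm (LINT x|\<mu>. ?g w x) = norm (fourier_transform \<mu> (u * a ^ n * F' (offset w)))"
      by (simp add: norm_mult)
    ultimately show ?thesis
      using int norm_triangle_sub[of "LINT x|\<mu>. ?f w x" "LINT x|\<mu>. ?g w x"] by simp
  qed
  have "fourier_transform (distr \<mu> borel F) u = (LINT x|\<mu>. cis (2 * pi * u * F x))"
    unfolding fourier_transform_cis by (rule integral_distr) auto
  also have "\<dots> = (\<Sum>w\<in>words n. weight w *\<^sub>R (LINT x|\<mu>. ?f w x))"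
    by (intro integral_words[where B = 1]) auto
  finally have "norm (fourier_transform (distr \<mu> borel F) u) \<le>
      (\<Sum>w\<in>words n. norm (weight w *\<^sub>R (LINT x|\<mu>. ?f w x)))"
    by (simp only: norm_sum)
  also have "\<dots> \<le> (\<Sum>w\<in>words n. weight w * (norm (fourier_transform \<mu> (u * a ^ n * F' (offset w))) + ?err))"
    using piece weight_nonneg by (intro sum_mono) (simp add: mult_left_mono)
  also have "\<dots> = (\<Sum>w\<in>words n. weight w * norm (fourier_transform \<mu> (u * a ^ n * F' (offset w)))) + ?err"
    unfolding distrib_left sum.distrib sum_distrib_right[symmetric] sum_weight by simp
  finally show ?thesis .
qed

end

section \<open>Power decay for nonlinear images\<close>

text \<open>Markov's inequality in pointwise form: it passes from a high moment to the mean.\<close>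

lemma le_threshold_plus_power:
  fixes x l :: real
  assumes "0 \<le> x" "x \<le> 1" "0 < l"
  shows "x \<le> l + x ^ Q / l ^ Q"
proof (cases "x \<le> l")
  case True
  then show ?thesis using assms by (simp add: add_increasing2)
next
  case False
  then have "1 \<le> (x / l) ^ Q" using assms by (intro one_le_power) simp
  then show ?thesis using assms by (simp only: power_divide)
qed

context homogeneous_ifs
begin

text \<open>Slopes that round together after multiplication by \<open>b\<close> differ by at most \<open>1 / \<bar>b\<bar>\<close>. Since \<open>F'\<close>
expands distances, the corresponding offsets lie in a short interval.\<close>

lemma sum_weight_same_round_le:
  assumes b: "b \<noteq> 0" and c: "0 < c"
    and expand: "\<And>x y. \<bar>x\<bar> \<le> R \<Longrightarrow> \<bar>y\<bar> \<le> R \<Longrightarrow> c * \<bar>x - y\<bar> \<le> \<bar>F' x - F' y\<bar>"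
  shows "\<exists>x. (\<Sum>w | w \<in> words n \<and> round (b * F' (offset w)) = k. weight w)
    \<le> measure \<mu> (cball x (1 / (\<bar>b\<bar> * c) + a ^ n * R))"
proof (cases "\<exists>w\<in>words n. round (b * F' (offset w)) = k")
  case False
  then have empty: "{w \<in> words n. round (b * F' (offset w)) = k} = {}" by auto
  show ?thesis unfolding empty by simp
next
  case True
  then obtain w0 where w0: "w0 \<in> words n" "round (b * F' (offset w0)) = k" by blast
  have near: "\<bar>offset w0 - offset w\<bar> \<le> 1 / (\<bar>b\<bar> * c)" if "round (b * F' (offset w)) = k" for w
  proof -
    have "\<bar>b * F' (offset w0) - b * F' (offset w)\<bar> \<le> 1"
      using round_eq_imp_diff_1[of "b * F' (offset w0)" "b * F' (offset w)"] w0 that by simp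
    then have "\<bar>b\<bar> * \<bar>F' (offset w0) - F' (offset w)\<bar> \<le> 1"
      by (simp add: abs_mult flip: right_diff_distrib)
    moreover have "\<bar>b\<bar> * (c * \<bar>offset w0 - offset w\<bar>) \<le> \<bar>b\<bar> * \<bar>F' (offset w0) - F' (offset w)\<bar>"
      using expand[OF abs_offset_le abs_offset_le] by (intro mult_left_mono) auto
    ultimately have "\<bar>b\<bar> * (c * \<bar>offset w0 - offset w\<bar>) \<le> 1" by linarith
    then show ?thesis using b c by (simp add: pos_le_divide_eq mult_ac)
  qed
  have "(\<Sum>w | w \<in> words n \<and> round (b * F' (offset w)) = k. weight w) \<le>
      (\<Sum>w | w \<in> words n \<and> \<bar>offset w0 - offset w\<bar> \<le> 1 / (\<bar>b\<bar> * c). weight w)"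
    using finite_words[of n] weight_nonneg near by (intro sum_mono2) auto
  also have "\<dots> \<le> measure \<mu> (cball (offset w0) (1 / (\<bar>b\<bar> * c) + a ^ n * R))"
    by (rule sum_weight_near_le)
  finally show ?thesis by blast
qed

text \<open>Choose \<open>n\<close> with \<open>\<bar>u\<bar>\<close> about \<open>a powr (- 3 * n / 2)\<close>. Then the linearisation error
\<open>\<bar>u\<bar> * (a ^ n)\<^sup>2\<close> is about \<open>a powr (n / 2)\<close>, while the frequencies \<open>u * a ^ n * F' (offset w)\<close> still
separate the offsets at scale \<open>a powr (n / 2)\<close>, where the Frostman condition gives mass
\<open>a powr (s * n / 2)\<close>. A moment growth of \<open>a powr (- s * n / 4)\<close> leaves \<open>a powr (s * n / 4)\<close> for
the \<open>Q\<close>-th moment, and the threshold \<open>a powr (s * n / (8 * Q))\<close> balances the passage to the mean.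
All exponents depend on \<open>\<mu>\<close> only; \<open>F\<close> affects the constants.\<close>

lemma fourier_image_decay:
  assumes ij: "0 < p $ i" "0 < p $ j" "t $ i \<noteq> t $ j"
  obtains \<sigma> where "0 < \<sigma>"
    "\<And>F. C2 F \<Longrightarrow> \<forall>x. deriv (deriv F) x > 0 \<Longrightarrow>
      \<exists>C>0. \<forall>u. u \<noteq> 0 \<longrightarrow> norm (fourier_transform (distr \<mu> borel F) u) \<le> C * \<bar>u\<bar> powr (- \<sigma>)"
proof -
  obtain s C\<^sub>\<mu> where s: "0 < s" and C\<mu>: "0 < C\<^sub>\<mu>"
    and ball: "\<And>x r. 0 < r \<Longrightarrow> measure \<mu> (cball x r) \<le> C\<^sub>\<mu> * r powr s"
    using measure_cball_le_powr[OF ij] by metis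
  define d where "d = t $ i - t $ j"
  have d: "0 < \<bar>d\<bar>" using ij by (simp add: d_def)
  \<comment> \<open>This rate consumes half of the Frostman gain \<open>a powr (s * n / 2)\<close>.\<close>
  define \<delta> where "\<delta> = a powr (- (s / 4)) - 1"
  have "1 < a powr (- (s / 4))"
    using powr_less_mono'[of a "- (s / 4)" 0] a_pos a_less_1 s by simp
  then have \<delta>: "0 < \<delta>" by (simp add: \<delta>_def)
  obtain Q where Q: "0 < Q" and moment:
    "\<And>E A N. \<lbrakk>finite E; inj_on round E; 0 \<le> A; \<forall>b\<in>E. \<bar>b\<bar> * a ^ N \<le> A\<rbrakk> \<Longrightarrow>
      (\<Sum>b\<in>E. norm (fourier_transform \<mu> (b / (a * d))) ^ Q) \<le> (2 * A + 2) * (1 + \<delta>) ^ N"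
    using fourier_moment_bound[OF ij \<delta>] unfolding d_def by blast
  define \<sigma>0 where "\<sigma>0 = min (s / (8 * Q)) (1/2)"
  \<comment> \<open>A gain of \<open>a powr (\<sigma>0 * n)\<close> is \<open>\<bar>u\<bar> powr (- \<sigma>)\<close> up to a constant, as \<open>\<bar>u\<bar>\<close> is about \<open>a powr (- 3 * n / 2)\<close>.\<close>
  define \<sigma> where "\<sigma> = 2 * \<sigma>0 / 3"
  have \<sigma>0: "0 < \<sigma>0" "\<sigma>0 \<le> 1/2" "\<sigma>0 \<le> s / (8 * Q)" using s Q by (auto simp: \<sigma>0_def)
  have "s / (8 * Q) \<le> s / 8" using s Q by (simp add: field_simps)
  then have \<sigma>0': "\<sigma>0 \<le> s / 8" using \<sigma>0 by linarith
  have \<sigma>: "0 < \<sigma>" using \<sigma>0 by (simp add: \<sigma>_def)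
  have "\<exists>C>0. \<forall>u. u \<noteq> 0 \<longrightarrow> norm (fourier_transform (distr \<mu> borel F) u) \<le> C * \<bar>u\<bar> powr (- \<sigma>)"
    if F: "C2 F" "\<forall>x. deriv (deriv F) x > 0" for F
  proof -
    define F' where "F' = deriv F"
    obtain c M where c: "0 < c" and M: "0 < M" and F'_le: "\<And>x. \<bar>x\<bar> \<le> 2 * R \<Longrightarrow> \<bar>F' x\<bar> \<le> M"
      and F'_ge: "\<And>x y. \<bar>x\<bar> \<le> 2 * R \<Longrightarrow> \<bar>y\<bar> \<le> 2 * R \<Longrightarrow> c * \<bar>x - y\<bar> \<le> \<bar>F' x - F' y\<bar>"
      and taylor: "\<And>x y. \<bar>x\<bar> \<le> 2 * R \<Longrightarrow> \<bar>y\<bar> \<le> 2 * R \<Longrightarrow> \<bar>F x - (F y + F' y * (x - y))\<bar> \<le> M * (x - y)\<^sup>2"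
    proof -
      have "0 \<le> 2 * R" using R_nonneg by simp
      from C2_convex_bounds[OF F this, folded F'_def] that show thesis by blast
    qed
    have cont: "continuous_on UNIV F"
      using F(1) by (simp add: C2_def differentiable_imp_continuous_on)
    have [measurable]: "F \<in> borel_measurable borel" using cont by (rule borel_measurable_continuous_onI)
    \<comment> \<open>The loss from rounding down to an integer \<open>n\<close>.\<close>
    define e where "e = a powr (- (3/2))"
    have e: "0 < e" using a_pos by (simp add: e_def)
    define L where "L = 1 / (a * \<bar>d\<bar> * c) + R"
    have L: "0 < L" using a_pos d c R_nonneg by (auto simp: L_def intro!: add_pos_nonneg)
    define A where "A = a * \<bar>d\<bar> * M * e"
    have A: "0 \<le> A" using a_pos d M e by (simp add: A_def)
    define C1 where "C1 = C\<^sub>\<mu> * L powr s * (2 * A + 2)"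
    have C1: "0 < C1" using C\<mu> L A by (simp add: C1_def)
    define K where "K = 1 + C1 + 2 * pi * M * R\<^sup>2 * e"
    have K: "1 \<le> K" using C1 M e by (simp add: K_def)
    define C where "C = K * a powr (- \<sigma>0)"
    have "1 \<le> a powr (- \<sigma>0)" using powr_mono'[of "- \<sigma>0" 0 a] a_pos a_less_1 \<sigma>0 by simp
    then have C: "1 \<le> C" using K mult_mono[of 1 K 1 "a powr (- \<sigma>0)"] by (simp add: C_def)
    have "norm (fourier_transform (distr \<mu> borel F) u) \<le> C * \<bar>u\<bar> powr (- \<sigma>)" if u: "u \<noteq> 0" for u
    proof (cases "\<bar>u\<bar> \<le> 1")
      case True
      have "norm (fourier_transform (distr \<mu> borel F) u) = norm (LINT x|\<mu>. cis (2 * pi * u * F x))"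
        unfolding fourier_transform_cis by (subst integral_distr) auto
      also have "\<dots> \<le> (LINT x|\<mu>. norm (cis (2 * pi * u * F x)))" by (rule integral_norm_bound)
      also have "\<dots> = 1" using prob_space.prob_space[OF prob_space_\<mu>] by simp
      also have "\<dots> \<le> C * 1" using C by simp
      also have "\<dots> \<le> C * \<bar>u\<bar> powr (- \<sigma>)"
      proof -
        have "1 \<le> \<bar>u\<bar> powr (- \<sigma>)" using powr_mono'[of "- \<sigma>" 0 "\<bar>u\<bar>"] u True \<sigma> by simp
        then show ?thesis using C by (intro mult_left_mono) auto
      qed
      finally show ?thesis .
    next
      case False
      define v where "v = - (2/3) * log a \<bar>u\<bar>"
      have uv: "\<bar>u\<bar> = a powr (- (3/2) * v)" using u a_pos a_less_1 by (simp add: v_def)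
      have "log a \<bar>u\<bar> \<le> 0" using False a_pos a_less_1 by (simp add: log_def divide_le_0_iff)
      then have v: "0 \<le> v" by (simp add: v_def)
      define n where "n = nat \<lfloor>v\<rfloor>"
      have n: "real n \<le> v" "v < real n + 1" using v by (auto simp: n_def)
      have an: "a ^ n = a powr real n" using a_pos by (simp add: powr_realpow)
      define z where "z = a powr (real n / 2)"
      have z: "0 < z" using a_pos by (simp add: z_def)
      have u_le: "\<bar>u\<bar> \<le> a powr (- (3/2) * (real n + 1))"
        unfolding uv using n a_pos a_less_1 by (intro powr_mono') auto
      have u_ge: "a powr (- (3/2) * real n) \<le> \<bar>u\<bar>"
        unfolding uv using n a_pos a_less_1 by (intro powr_mono') auto
      have u2: "\<bar>u\<bar> * (a ^ n)\<^sup>2 \<le> e * z"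
      proof -
        have "\<bar>u\<bar> * (a ^ n)\<^sup>2 \<le> a powr (- (3/2) * (real n + 1)) * (a ^ n)\<^sup>2"
          using u_le by (rule mult_right_mono) simp
        also have "\<dots> = e * z"
          by (simp add: an e_def z_def power2_eq_square flip: powr_add) (simp add: field_simps)
        finally show ?thesis .
      qed
      have u1: "1 \<le> z * (\<bar>u\<bar> * a ^ n)"
      proof -
        have "1 = z * (a powr (- (3/2) * real n) * a ^ n)"
          using a_pos by (simp add: an z_def flip: powr_add)
        also have "\<dots> \<le> z * (\<bar>u\<bar> * a ^ n)"
          using u_ge z a_pos by (intro mult_left_mono mult_right_mono) auto
        finally show ?thesis .
      qed
      have z1: "z \<le> 1" using powr_mono'[of 0 "real n / 2" a] a_pos a_less_1 by (simp add: z_def)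
      have anz: "a ^ n \<le> z" unfolding an z_def using a_pos a_less_1 by (intro powr_mono') auto
      define \<beta> where "\<beta> w = a * d * u * a ^ n * F' (offset w)" for w
      have \<beta>_div: "\<beta> w / (a * d) = u * a ^ n * F' (offset w)" for w
        using a_pos d by (simp add: \<beta>_def)
      let ?f = "\<lambda>w. norm (fourier_transform \<mu> (u * a ^ n * F' (offset w)))"
      have offset: "\<bar>offset w\<bar> \<le> 2 * R" for w using abs_offset_le[of w] by linarith
      have size: "\<bar>\<beta> w\<bar> * a ^ n \<le> A" for w
      proof -
        have "\<bar>\<beta> w\<bar> * a ^ n = a * \<bar>d\<bar> * \<bar>F' (offset w)\<bar> * (\<bar>u\<bar> * (a ^ n)\<^sup>2)"
          using a_pos by (simp add: \<beta>_def abs_mult power2_eq_square)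
        also have "\<dots> \<le> a * \<bar>d\<bar> * M * e"
        proof (rule mult_mono)
          show "a * \<bar>d\<bar> * \<bar>F' (offset w)\<bar> \<le> a * \<bar>d\<bar> * M"
            using a_pos F'_le[OF offset] by (intro mult_left_mono) auto
          show "\<bar>u\<bar> * (a ^ n)\<^sup>2 \<le> e" using u2 z1 e mult_left_mono[of z 1 e] by linarith
        qed (use a_pos M in auto)
        finally show ?thesis by (simp add: A_def)
      qed
      have mass: "(\<Sum>w | w \<in> words n \<and> round (\<beta> w) = k. weight w) \<le> C\<^sub>\<mu> * (L * z) powr s" for k
      proof -
        define b where "b = a * d * u * a ^ n"
        have b: "b \<noteq> 0" using a_pos d u by (simp add: b_def)
        have expand: "c * \<bar>x - y\<bar> \<le> \<bar>F' x - F' y\<bar>" if "\<bar>x\<bar> \<le> R" "\<bar>y\<bar> \<le> R" for x y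
          using that R_nonneg by (intro F'_ge) auto
        obtain x where x: "(\<Sum>w | w \<in> words n \<and> round (b * F' (offset w)) = k. weight w) \<le>
            measure \<mu> (cball x (1 / (\<bar>b\<bar> * c) + a ^ n * R))"
          using sum_weight_same_round_le[of b c F' n k, OF b c expand] by blast
        have "1 / (\<bar>b\<bar> * c) \<le> z / (a * \<bar>d\<bar> * c)"
        proof -
          have "a * \<bar>d\<bar> * c * 1 \<le> a * \<bar>d\<bar> * c * (z * (\<bar>u\<bar> * a ^ n))"
            using u1 a_pos c by (intro mult_left_mono) auto
          also have "\<dots> = z * (\<bar>b\<bar> * c)" using a_pos by (simp add: b_def abs_mult)
          finally show ?thesis using a_pos b c d by (simp add: field_simps)
        qed
        then have "1 / (\<bar>b\<bar> * c) + a ^ n * R \<le> L * z"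
          using mult_right_mono[OF anz R_nonneg] by (simp add: L_def algebra_simps)
        then have "cball x (1 / (\<bar>b\<bar> * c) + a ^ n * R) \<subseteq> cball x (L * z)" by (rule subset_cball)
        then have "measure \<mu> (cball x (1 / (\<bar>b\<bar> * c) + a ^ n * R)) \<le> measure \<mu> (cball x (L * z))"
          by (intro finite_measure.finite_measure_mono[OF prob_space.finite_measure[OF prob_space_\<mu>]]) auto
        also have "\<dots> \<le> C\<^sub>\<mu> * (L * z) powr s" using L z by (intro ball) simp
        finally show ?thesis using x by (simp add: \<beta>_def b_def)
      qed
      have moment_n: "(\<Sum>w\<in>words n. weight w * ?f w ^ Q) \<le> C1 * a powr (s * real n / 4)"
      proof -
        define h where "h b = norm (fourier_transform \<mu> (b / (a * d))) ^ Q" for b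
        obtain E where E: "E \<subseteq> \<beta> ` words n" "inj_on round E"
          and "(\<Sum>w\<in>words n. weight w * h (\<beta> w)) \<le> C\<^sub>\<mu> * (L * z) powr s * (\<Sum>b\<in>E. h b)"
          using weighted_sum_le_separated_sum[of "words n" weight h \<beta>, OF finite_words weight_nonneg _ mass]
          by (auto simp: h_def)
        then have "(\<Sum>w\<in>words n. weight w * ?f w ^ Q) \<le> C\<^sub>\<mu> * (L * z) powr s * (\<Sum>b\<in>E. h b)"
          by (simp only: h_def \<beta>_div)
        also have "\<dots> \<le> C\<^sub>\<mu> * (L * z) powr s * ((2 * A + 2) * (1 + \<delta>) ^ n)"
        proof (intro mult_left_mono)
          have "finite E" using E(1) finite_words finite_surj by blast
          then show "(\<Sum>b\<in>E. h b) \<le> (2 * A + 2) * (1 + \<delta>) ^ n"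
            unfolding h_def using E size by (intro moment A) auto
        qed (use C\<mu> in auto)
        also have "(1 + \<delta>) ^ n = a powr (- (s / 4) * real n)"
          using a_pos by (simp add: \<delta>_def powr_powr flip: powr_realpow)
        also have "(L * z) powr s = L powr s * a powr (s * real n / 2)"
          using L z by (simp add: powr_mult z_def powr_powr mult.commute)
        also have "C\<^sub>\<mu> * (L powr s * a powr (s * real n / 2)) * ((2 * A + 2) * a powr (- (s / 4) * real n)) =
            C1 * (a powr (s * real n / 2) * a powr (- (s / 4) * real n))"
          by (simp add: C1_def mult_ac)
        also have "a powr (s * real n / 2) * a powr (- (s / 4) * real n) = a powr (s * real n / 4)"
          by (simp flip: powr_add)
        finally show ?thesis .
      qed
      define l where "l = a powr (s / (8 * Q) * real n)"
      have l: "0 < l" using a_pos by (simp add: l_def)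
      have lQ: "l ^ Q = a powr (s * real n / 8)"
        using a_pos Q by (simp add: l_def powr_powr flip: powr_realpow)
      define g where "g = a powr (\<sigma>0 * real n)"
      have small: "a powr (x * real n) \<le> g" if "\<sigma>0 \<le> x" for x
        unfolding g_def using that a_pos a_less_1 by (intro powr_mono' mult_right_mono) auto
      have "(\<Sum>w\<in>words n. weight w * ?f w) \<le> (\<Sum>w\<in>words n. weight w * (l + ?f w ^ Q / l ^ Q))"
        using norm_fourier_\<mu>_le_1 weight_nonneg l
        by (intro sum_mono mult_left_mono le_threshold_plus_power) auto
      also have "\<dots> = l + (\<Sum>w\<in>words n. weight w * ?f w ^ Q) / l ^ Q"
        unfolding distrib_left sum.distrib sum_distrib_right[symmetric] sum_weight
        by (simp add: sum_divide_distrib)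
      also have "\<dots> \<le> l + C1 * a powr (s * real n / 4) / l ^ Q"
        using moment_n l by (intro add_left_mono divide_right_mono) auto
      also have "\<dots> = l + C1 * a powr (s / 8 * real n)"
        unfolding lQ using a_pos by (simp add: field_simps flip: powr_add)
      also have "\<dots> \<le> g + C1 * g"
        unfolding l_def using small[OF \<sigma>0(3)] small[OF \<sigma>0'] C1 by (intro add_mono mult_left_mono) auto
      finally have main: "(\<Sum>w\<in>words n. weight w * ?f w) \<le> g + C1 * g" .
      have "z \<le> g" using small[OF \<sigma>0(2)] by (simp add: z_def)
      have "norm (fourier_transform (distr \<mu> borel F) u) \<le>
          (\<Sum>w\<in>words n. weight w * ?f w) + 2 * pi * M * R\<^sup>2 * (\<bar>u\<bar> * (a ^ n)\<^sup>2)"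
        by (rule fourier_image_linearised[OF cont taylor]) (use M in auto)
      also have "\<dots> \<le> (g + C1 * g) + 2 * pi * M * R\<^sup>2 * (e * g)"
      proof (intro add_mono main mult_left_mono)
        show "\<bar>u\<bar> * (a ^ n)\<^sup>2 \<le> e * g" using u2 \<open>z \<le> g\<close> e mult_left_mono[of z g e] by linarith
      qed (use M in auto)
      also have "\<dots> = K * g" by (simp add: K_def algebra_simps)
      also have "g = a powr (- \<sigma>0) * a powr (\<sigma>0 * (real n + 1))"
        by (simp add: g_def algebra_simps flip: powr_add)
      also have "K * (a powr (- \<sigma>0) * a powr (\<sigma>0 * (real n + 1))) \<le> C * \<bar>u\<bar> powr (- \<sigma>)"
      proof -
        have "(a powr (- (3/2) * (real n + 1))) powr (- \<sigma>) \<le> \<bar>u\<bar> powr (- \<sigma>)"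
          using u_le \<sigma> u by (intro powr_mono2') auto
        moreover have "- (3/2) * (real n + 1) * (- \<sigma>) = \<sigma>0 * (real n + 1)" by (simp add: \<sigma>_def)
        ultimately have "a powr (\<sigma>0 * (real n + 1)) \<le> \<bar>u\<bar> powr (- \<sigma>)"
          by (simp only: powr_powr)
        then show ?thesis using K by (simp add: C_def mult.assoc mult_left_mono)
      qed
      finally show ?thesis .
    qed
    then show ?thesis using C by (intro exI[of _ C]) auto
  qed
  then show ?thesis using that \<sigma> by blast
qed

end

theorem theorem3p1:
  fixes a :: real and t p :: "real ^ 'm" and \<mu> :: "real measure"
  assumes "0 < a" and "a < 1"
    and "probability_vector p"
    and "\<mu> = self_similar_measure a t p"
    and "\<nexists>x. \<mu> = return borel x"
  shows "\<exists>\<sigma>>0. \<forall>F :: real \<Rightarrow> real. C2 F \<and> (\<forall>x. deriv (deriv F) x > 0) \<longrightarrow>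
           (\<exists>C>0. \<forall>u. u \<noteq> 0 \<longrightarrow>
             norm (fourier_transform (distr \<mu> borel F) u) \<le> C * \<bar>u\<bar> powr (- \<sigma>))"
proof -
  interpret homogeneous_ifs a t p by unfold_locales fact+
  obtain i j where "0 < p $ i" "0 < p $ j" "t $ i \<noteq> t $ j"
    using two_translations_if_not_atom assms(4,5) by blast
  from fourier_image_decay[OF this] show ?thesis unfolding assms(4) by metis
qed

end
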